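(* Let $\alpha>-2$, $\alpha^-:=\min\{\alpha,0\}$, and $3\le N<10+4\alpha^-$. Let $F,Q,F^0$ be as in the context, and assume moreover that $$\langle F_\xi(x),F^0_\xi(y)\rangle=\frac{\langle x,y\rangle}{F(x)F^0(y)}\quad\text{for all }x,y\in\mathbb{R}^N\ (x,y\neq0).$$ Then the equation $-Qu=(F^0(x))^\alpha e^u$ in $\mathbb{R}^N$ admits no weak solution which is stable outside a compact set.
   Context: Standing assumptions on $F$: $F:\mathbb{R}^N\to[0,\infty)$ is convex, $F\in C^2(\mathbb{R}^N\setminus\{0\})$, $F(t\xi)=|t|F(\xi)$, $F(\xi)>0$ for $\xi\neq0$; $a|\xi|\le F(\xi)\le b|\xi|$ for constants $0<a\le b$; and $\mu^2|V|^2\le\sum_{i,j}F_{\xi_i\xi_j}(\xi)V_iV_j\le\Lambda|V|^2$ for all unit $\xi$ and all $V\perp\xi$. $Qu:=\sum_i\partial_{x_i}(F(\nabla u)F_{\xi_i}(\nabla u))$. $F^0(x):=\sup_{F(\xi)<1}\langle x,\xi\rangle$; $F_\xi=\nabla F$, $F^0_\xi=\nabla F^0$. A weak solution on $\mathbb{R}^N$ is $u\in H^1_{loc}(\mathbb{R}^N)$ with $(F^0)^\alpha e^u\in L^1_{loc}$ and $\int F(\nabla u)F_\xi(\nabla u)\cdot\nabla\phi=\int(F^0)^\alpha e^u\phi$ for all $\phi\in C_c^\infty(\mathbb{R}^N)$. It is stable outside a compact set if there is a compact $S\subset\mathbb{R}^N$ such that $\int\big[F_{\xi_i}(\nabla u)F_{\xi_j}(\nabla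 u)\phi_{x_i}\phi_{x_j}+F(\nabla u)F_{\xi_i\xi_j}(\nabla u)\phi_{x_i}\phi_{x_j}-(F^0)^\alpha e^u\phi^2\big]dx\ge0$ for all $\phi\in C_c^\infty(\mathbb{R}^N\setminus S)$. *)

theory Defs
  imports "HOL-Analysis.Analysis"
begin

(* gradient of a real function on a Euclidean space; set to 0 where not differentiable
   (in particular F_xi(0) := 0 for the norm-like F, which is only relevant multiplied by F(0)=0) *)
definition Fgrad :: "('a::euclidean_space \<Rightarrow> real) \<Rightarrow> 'a \<Rightarrow> 'a" where
  "Fgrad f x = (if f differentiable (at x)
                then (\<Sum>i\<in>Basis. frechet_derivative f (at x) i *\<^sub>R i) else 0)"

definition pderiv :: "('a::euclidean_space \<Rightarrow> real) \<Rightarrow> 'a \<Rightarrow> 'a \<Rightarrow> real" where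
  "pderiv f j x = frechet_derivative f (at x) j"

definition hess :: "('a::euclidean_space \<Rightarrow> real) \<Rightarrow> 'a \<Rightarrow> 'a \<Rightarrow> 'a \<Rightarrow> real" where
  "hess f x i j = pderiv (\<lambda>y. Fgrad f y \<bullet> i) j x"

definition C2_on :: "'a::euclidean_space set \<Rightarrow> ('a \<Rightarrow> real) \<Rightarrow> bool" where
  "C2_on S f \<longleftrightarrow> open S \<and>
     (\<forall>x\<in>S. f differentiable (at x) \<and> (\<forall>i\<in>Basis. (\<lambda>y. Fgrad f y \<bullet> i) differentiable (at x))) \<and>
     (\<forall>i\<in>Basis. \<forall>j\<in>Basis. continuous_on S (\<lambda>y. hess f y i j))"

fun Ck :: "nat \<Rightarrow> ('a::euclidean_space \<Rightarrow> real) \<Rightarrow> bool" where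
  "Ck 0 f = continuous_on UNIV f"
| "Ck (Suc k) f = ((\<forall>x. f differentiable (at x)) \<and> (\<forall>j\<in>Basis. Ck k (pderiv f j)))"

definition smooth :: "('a::euclidean_space \<Rightarrow> real) \<Rightarrow> bool" where
  "smooth f \<longleftrightarrow> (\<forall>k. Ck k f)"

definition tsupport :: "('a::euclidean_space \<Rightarrow> real) \<Rightarrow> 'a set" where
  "tsupport f = closure {x. f x \<noteq> 0}"

definition test_fun_on :: "'a::euclidean_space set \<Rightarrow> ('a \<Rightarrow> real) \<Rightarrow> bool" where
  "test_fun_on \<Omega> \<phi> \<longleftrightarrow> smooth \<phi> \<and> compact (tsupport \<phi>) \<and> tsupport \<phi> \<subseteq> \<Omega>"

definition L1_loc :: "('a::euclidean_space \<Rightarrow> real) \<Rightarrow> bool" where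
  "L1_loc f \<longleftrightarrow> (\<forall>K. compact K \<longrightarrow> set_integrable lborel K f)"

definition L2_loc :: "('a::euclidean_space \<Rightarrow> real) \<Rightarrow> bool" where
  "L2_loc f \<longleftrightarrow> f \<in> borel_measurable lborel \<and>
     (\<forall>K. compact K \<longrightarrow> set_integrable lborel K (\<lambda>x. (f x)\<^sup>2))"

definition H1_loc_grad :: "('a::euclidean_space \<Rightarrow> real) \<Rightarrow> ('a \<Rightarrow> 'a) \<Rightarrow> bool" where
  "H1_loc_grad u G \<longleftrightarrow> L2_loc u \<and> (\<forall>i\<in>Basis. L2_loc (\<lambda>x. G x \<bullet> i)) \<and>
     (\<forall>\<phi>. test_fun_on UNIV \<phi> \<longrightarrow> (\<forall>i\<in>Basis.
        (\<integral>x. u x * pderiv \<phi> i x \<partial>lborel) = - (\<integral>x. (G x \<bullet> i) * \<phi> x \<partial>lborel)))"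

definition Fdual :: "('a::euclidean_space \<Rightarrow> real) \<Rightarrow> 'a \<Rightarrow> real" where
  "Fdual F x = Sup {x \<bullet> \<xi> | \<xi>. F \<xi> < 1}"

definition weak_sol_grad :: "('a::euclidean_space \<Rightarrow> real) \<Rightarrow> real \<Rightarrow> ('a \<Rightarrow> real) \<Rightarrow> ('a \<Rightarrow> 'a) \<Rightarrow> bool" where
  "weak_sol_grad F \<alpha> u G \<longleftrightarrow> H1_loc_grad u G \<and>
     L1_loc (\<lambda>x. Fdual F x powr \<alpha> * exp (u x)) \<and>
     (\<forall>\<phi>. test_fun_on UNIV \<phi> \<longrightarrow>
        (\<integral>x. F (G x) * (Fgrad F (G x) \<bullet> Fgrad \<phi> x) \<partial>lborel)
          = (\<integral>x. Fdual F x powr \<alpha> * exp (u x) * \<phi> x \<partial>lborel))"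

definition weak_solution :: "('a::euclidean_space \<Rightarrow> real) \<Rightarrow> real \<Rightarrow> ('a \<Rightarrow> real) \<Rightarrow> bool" where
  "weak_solution F \<alpha> u \<longleftrightarrow> (\<exists>G. weak_sol_grad F \<alpha> u G)"

definition stable_outside_compact :: "('a::euclidean_space \<Rightarrow> real) \<Rightarrow> real \<Rightarrow> ('a \<Rightarrow> real) \<Rightarrow> bool" where
  "stable_outside_compact F \<alpha> u \<longleftrightarrow> (\<exists>G S. weak_sol_grad F \<alpha> u G \<and> compact S \<and>
     (\<forall>\<phi>. test_fun_on (- S) \<phi> \<longrightarrow>
        (\<integral>x. (\<Sum>i\<in>Basis. \<Sum>j\<in>Basis.
               (Fgrad F (G x) \<bullet> i) * (Fgrad F (G x) \<bullet> j) * pderiv \<phi> i x * pderiv \<phi> j x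
             + F (G x) * hess F (G x) i j * pderiv \<phi> i x * pderiv \<phi> j x)
           - Fdual F x powr \<alpha> * exp (u x) * (\<phi> x)\<^sup>2 \<partial>lborel) \<ge> 0))"

end

theory Submission
  imports Defs "HOL-Real_Asymp.Real_Asymp"
begin

text \<open>
  Write \<open>\<rho>\<close> for the dual norm, \<open>q = \<rho>\<^sup>2\<close>, \<open>N\<close> for the dimension and \<open>k = N - 2\<close>.
  The duality identity says that \<open>\<nabla>(F\<^sup>2/2)(\<xi>) \<bullet> \<nabla>(\<rho>\<^sup>2/2)(y) = \<xi> \<bullet> y\<close>. Since
  \<open>\<nabla>(F\<^sup>2/2)(v) \<bullet> v = F(v)\<^sup>2\<close>, it forces \<open>\<nabla>(\<rho>\<^sup>2/2)\<close> to be linear, so \<open>q\<close> is a quadratic form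
  and test functions that are smooth functions of \<open>q\<close> are admissible. On these the
  equation becomes linear in \<open>u\<close> and the stability form becomes that of the Laplacian.

  Stability tested with a cut-off of \<open>\<rho>\<close> to the power \<open>-k/2\<close>, the Hardy extremal, bounds the
  integral of \<open>\<rho>\<^sup>\<alpha> e\<^sup>u\<close> against \<open>\<rho>\<close> to the power \<open>-k\<close> over \<open>q \<le> T\<close> by a multiple of \<open>(k\<^sup>2/4) ln T\<close>.
  Testing the equation with a truncated fundamental solution then shows that the mean of \<open>u\<close>
  over \<open>q \<sim> T\<close> is at least \<open>-(k/8) ln T - C\<close>. By Jensen's inequality the mean of \<open>e\<^sup>u\<close> is at
  least a multiple of \<open>T\<close> to the power \<open>-k/8\<close>, whereas stability bounds it by
  \<open>ln T\<close> times \<open>T\<close> to the power \<open>-\<alpha>/2 - 1\<close>. These are incompatible when \<open>k < 4 (\<alpha> + 2)\<close>.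
\<close>

section \<open>Smooth functions\<close>

lemma pderiv_eqI:
  assumes "(f has_derivative f') (at x)"
  shows "pderiv f j x = f' j"
  unfolding Defs.pderiv_def using frechet_derivative_at[OF assms] by simp

lemma Fgrad_eqI:
  assumes "(f has_derivative (\<lambda>h. w \<bullet> h)) (at x)"
  shows "Fgrad f x = w"
proof -
  have "f differentiable (at x)"
    using assms by (auto simp: differentiable_def)
  then show ?thesis
    unfolding Fgrad_def using frechet_derivative_at[OF assms, symmetric]
    by (simp add: euclidean_representation)
qed

lemma Fgrad_has_derivative:
  assumes "f differentiable (at x)"
  shows "(f has_derivative (\<lambda>h. Fgrad f x \<bullet> h)) (at x)"
proof -
  have *: "(f has_derivative frechet_derivative f (at x)) (at x)"
    using assms by (simp add: frechet_derivative_works)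
  interpret linear "frechet_derivative f (at x)"
    using * by (rule has_derivative_linear)
  have "frechet_derivative f (at x) h = Fgrad f x \<bullet> h" for h
  proof -
    have "frechet_derivative f (at x) h
        = frechet_derivative f (at x) (\<Sum>i\<in>Basis. (h \<bullet> i) *\<^sub>R i)"
      by (simp add: euclidean_representation)
    also have "\<dots> = Fgrad f x \<bullet> h"
      using assms by (simp add: Fgrad_def sum scaleR inner_sum_left inner_commute[of h] mult.commute)
    finally show ?thesis .
  qed
  then show ?thesis
    using * by (metis (no_types, lifting) ext)
qed

lemma Ck_SucI:
  assumes "\<And>x. (f has_derivative f' x) (at x)" "\<And>j. j \<in> Basis \<Longrightarrow> Ck k (\<lambda>x. f' x j)"
  shows "Ck (Suc k) f"
proof -
  have "pderiv f j = (\<lambda>x. f' x j)" for j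
    using pderiv_eqI[OF assms(1)] by auto
  moreover have "f differentiable (at x)" for x
    using assms(1) by (auto simp: differentiable_def)
  ultimately show ?thesis
    using assms(2) by simp
qed

lemma Ck_Suc_has_derivative:
  assumes "Ck (Suc k) f"
  shows "(f has_derivative frechet_derivative f (at x)) (at x)"
  using assms by (simp add: frechet_derivative_works)

text \<open>\<open>Ck\<close> asks for continuity only at the top order, so descending one order
  rests on differentiable functions being continuous, at the base of the induction.\<close>

lemma Ck_Suc_imp_Ck: "Ck (Suc k) f \<Longrightarrow> Ck k f"
proof (induction k arbitrary: f)
  case 0
  then show ?case
    by (auto intro!: continuous_at_imp_continuous_on differentiable_imp_continuous_within)
next
  case (Suc k)
  have 1: "f differentiable (at x)" for x
    using Suc.prems by simp
  have 2: "Ck k (pderiv f j)" if "j \<in> Basis" for j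
    using Suc.prems Suc.IH[of "pderiv f j"] that Ck.simps(2) by blast
  show ?case
    using 1 2 by simp
qed

lemma Ck_const: "Ck k (\<lambda>x. c)"
proof (induction k arbitrary: c)
  case (Suc k)
  show ?case
    by (rule Ck_SucI[of _ "\<lambda>x h. 0"]) (auto intro: Suc)
qed simp

lemma Ck_linear:
  assumes "bounded_linear f"
  shows "Ck k f"
proof (cases k)
  case 0
  then show ?thesis using assms by (simp add: linear_continuous_on)
next
  case (Suc n)
  show ?thesis
    unfolding Suc by (rule Ck_SucI[of _ "\<lambda>x. f"])
      (auto intro: Ck_const bounded_linear_imp_has_derivative assms)
qed

lemma Ck_add: "Ck k f \<Longrightarrow> Ck k g \<Longrightarrow> Ck k (\<lambda>x. f x + g x)"
proof (induction k arbitrary: f g)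
  case (Suc k)
  show ?case
  proof (rule Ck_SucI)
    show "((\<lambda>x. f x + g x) has_derivative
        (\<lambda>h. frechet_derivative f (at x) h + frechet_derivative g (at x) h)) (at x)" for x
      using Suc.prems[THEN Ck_Suc_has_derivative] by (intro has_derivative_add)
    show "Ck k (\<lambda>x. frechet_derivative f (at x) j + frechet_derivative g (at x) j)"
      if "j \<in> Basis" for j
      using Suc.IH[of "pderiv f j" "pderiv g j"] Suc.prems that
      by (simp add: Defs.pderiv_def[abs_def])
  qed
qed (auto intro: continuous_intros)

lemma Ck_mult: "Ck k f \<Longrightarrow> Ck k g \<Longrightarrow> Ck k (\<lambda>x. f x * g x)"
proof (induction k arbitrary: f g)
  case (Suc k)
  show ?case
  proof (rule Ck_SucI)
    show "((\<lambda>x. f x * g x) has_derivative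
        (\<lambda>h. f x * frechet_derivative g (at x) h + frechet_derivative f (at x) h * g x)) (at x)" for x
      using Suc.prems[THEN Ck_Suc_has_derivative] by (intro has_derivative_mult)
    show "Ck k (\<lambda>x. f x * frechet_derivative g (at x) j + frechet_derivative f (at x) j * g x)"
      if "j \<in> Basis" for j
      using Ck_add[OF Suc.IH[of f "pderiv g j"] Suc.IH[of "pderiv f j" g]]
        Suc.prems[THEN Ck_Suc_imp_Ck] Suc.prems that
      by (simp add: Defs.pderiv_def[abs_def])
  qed
qed (auto intro: continuous_intros)

lemma Ck_compose:
  fixes p :: "real \<Rightarrow> real"
  shows "Ck k p \<Longrightarrow> Ck k f \<Longrightarrow> Ck k (\<lambda>x. p (f x))"
proof (induction k arbitrary: p)
  case 0
  then show ?case
    using continuous_on_compose2[of UNIV p UNIV f] by simp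
next
  case (Suc k)
  have p: "(p has_real_derivative pderiv p 1 t) (at t)" for t
    using Ck_Suc_has_derivative[OF Suc.prems(1), of t]
    unfolding has_field_derivative_def Defs.pderiv_def
    by (metis has_derivative_linear linear_scale_real mult.commute mult.right_neutral ext)
  show ?case
  proof (rule Ck_SucI)
    show "((\<lambda>x. p (f x)) has_derivative
        (\<lambda>h. pderiv p 1 (f x) * frechet_derivative f (at x) h)) (at x)" for x
      using has_derivative_compose[OF Ck_Suc_has_derivative[OF Suc.prems(2)]
          p[unfolded has_field_derivative_def]] by simp
    show "Ck k (\<lambda>x. pderiv p 1 (f x) * frechet_derivative f (at x) j)"
      if "j \<in> Basis" for j
      using Ck_mult[OF Suc.IH[of "pderiv p 1"], of "pderiv f j"]
        Suc.prems(2)[THEN Ck_Suc_imp_Ck] Suc.prems that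
      by (simp add: Defs.pderiv_def[abs_def])
  qed
qed

lemma smooth_const: "smooth (\<lambda>x. c)"
  and smooth_linear: "bounded_linear f \<Longrightarrow> smooth f"
  and smooth_add: "smooth f \<Longrightarrow> smooth g \<Longrightarrow> smooth (\<lambda>x. f x + g x)"
  and smooth_mult: "smooth f \<Longrightarrow> smooth g \<Longrightarrow> smooth (\<lambda>x. f x * g x)"
  and smooth_compose: "smooth p \<Longrightarrow> smooth f \<Longrightarrow> smooth (\<lambda>x. p (f x))" for p :: "real \<Rightarrow> real"
  by (auto simp: smooth_def intro: Ck_const Ck_linear Ck_add Ck_mult Ck_compose)

lemma smooth_minus: "smooth f \<Longrightarrow> smooth (\<lambda>x. - f x)"
  using smooth_mult[OF smooth_const[of "-1"], of f] by simp

lemma smooth_diff: "smooth f \<Longrightarrow> smooth g \<Longrightarrow> smooth (\<lambda>x. f x - g x)"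
  using smooth_add[OF _ smooth_minus[of g], of f] by simp

lemma smoothI:
  assumes "\<And>x. (f has_derivative f' x) (at x)" "\<And>j. j \<in> Basis \<Longrightarrow> smooth (\<lambda>x. f' x j)"
  shows "smooth f"
  unfolding smooth_def
proof
  fix k
  have "Ck (Suc k) f"
    using assms by (intro Ck_SucI) (auto simp: smooth_def)
  then show "Ck k f" by (rule Ck_Suc_imp_Ck)
qed

lemma smooth_realI:
  fixes f :: "real \<Rightarrow> real"
  assumes "\<And>t. (f has_real_derivative f' t) (at t)" "smooth f'"
  shows "smooth f"
  using assms by (intro smoothI[of f "\<lambda>x. (*) (f' x)"]) (auto simp: has_field_derivative_def)

lemma smooth_has_derivative:
  assumes "smooth f"
  shows "(f has_derivative frechet_derivative f (at x)) (at x)"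
  using assms Ck_Suc_has_derivative[of 0 f x] unfolding smooth_def by blast

lemma smooth_pderiv: "smooth f \<Longrightarrow> j \<in> Basis \<Longrightarrow> smooth (pderiv f j)"
  unfolding smooth_def using Ck.simps(2) by blast

lemma smooth_continuous_on: "smooth f \<Longrightarrow> continuous_on A f"
  unfolding smooth_def using Ck.simps(1) continuous_on_subset by blast

lemma smooth_real_deriv:
  fixes f :: "real \<Rightarrow> real"
  assumes "smooth f"
  shows "(f has_real_derivative pderiv f 1 t) (at t)" "smooth (pderiv f 1)"
proof -
  have *: "(f has_derivative frechet_derivative f (at t)) (at t)"
    using assms by (rule smooth_has_derivative)
  have "frechet_derivative f (at t) h = pderiv f 1 t * h" for h
    using linear_scale[OF has_derivative_linear[OF *], of h 1] by (simp add: Defs.pderiv_def)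
  then show "(f has_real_derivative pderiv f 1 t) (at t)"
    using * unfolding has_field_derivative_def by (metis (no_types, lifting) ext)
  show "smooth (pderiv f 1)"
    using assms by (rule smooth_pderiv) simp
qed

lemma smooth_ident: "smooth (\<lambda>t::real. t)"
  by (rule smooth_linear[OF bounded_linear_ident])

lemma has_real_derivative_zero_below:
  fixes f :: "real \<Rightarrow> real"
  assumes "\<And>t. t < \<tau> \<Longrightarrow> f t = 0" "t < \<tau>"
  shows "(f has_real_derivative 0) (at t)"
  by (rule has_field_derivative_transform_within_open[of "\<lambda>_. 0" 0 t "{..<\<tau>}"])
    (use assms in auto)

lemma deriv_zero_above:
  fixes g g' :: "real \<Rightarrow> real"
  assumes "\<And>t. t > c \<Longrightarrow> g t = 0" "\<And>t. (g has_real_derivative g' t) (at t)" "t > c"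
  shows "g' t = 0"
proof -
  have "(g has_real_derivative 0) (at t)"
    by (rule has_field_derivative_transform_within_open[of "\<lambda>_. 0" 0 t "{c<..}"])
      (use assms in auto)
  then show ?thesis using assms(2) DERIV_unique by blast
qed

text \<open>Since \<open>\<beta>\<close> vanishes below a positive \<open>\<tau>\<close>, the power
  is only seen where it is smooth. The induction ranges over \<open>s\<close> and
  \<open>\<beta>\<close> together because the derivative has the same form with exponent
  \<open>s - 1\<close>.\<close>

lemma smooth_powr_mult:
  fixes \<beta> :: "real \<Rightarrow> real"
  assumes "smooth \<beta>" "\<tau> > 0" "\<And>t. t < \<tau> \<Longrightarrow> \<beta> t = 0"
  shows "smooth (\<lambda>t. t powr s * \<beta> t)"
proof -
  have "Ck k (\<lambda>t. t powr s * \<beta> t)" for k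
    using assms
  proof (induction k arbitrary: s \<beta>)
    case (0 s \<beta>)
    have "isCont (\<lambda>t. t powr s * \<beta> t) t" for t
    proof (cases "t < \<tau>")
      case True
      then show ?thesis
        using has_real_derivative_zero_below[of \<tau> "\<lambda>t. t powr s * \<beta> t" t] 0 DERIV_isCont by auto
    next
      case False
      have "isCont \<beta> t"
        using smooth_real_deriv(1)[OF 0(1)] DERIV_isCont by blast
      then show ?thesis
        using False \<open>\<tau> > 0\<close> by (intro continuous_intros) auto
    qed
    then show ?case by (simp add: continuous_at_imp_continuous_on)
  next
    case (Suc k s \<beta>)
    define \<beta>' where "\<beta>' = pderiv \<beta> 1"
    have \<beta>': "(\<beta> has_real_derivative \<beta>' t) (at t)" "smooth \<beta>'" for t
      using smooth_real_deriv[OF Suc.prems(1)] by (auto simp: \<beta>'_def)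
    have zero: "\<beta>' t = 0" if "t < \<tau>" for t
      using has_real_derivative_zero_below[of \<tau> \<beta> t] Suc.prems that \<beta>' DERIV_unique by blast
    \<comment> \<open>What remains of the product rule after pulling out
      \<open>t powr (s - 1)\<close>; it inherits smoothness and the vanishing below
      \<open>\<tau>\<close>.\<close>
    define \<gamma> where "\<gamma> t = s * \<beta> t + t * \<beta>' t" for t
    have \<gamma>: "smooth \<gamma>" "\<And>t. t < \<tau> \<Longrightarrow> \<gamma> t = 0"
      using Suc.prems zero unfolding \<gamma>_def
      by (auto intro!: smooth_add smooth_mult smooth_const smooth_ident \<beta>')
    have "((\<lambda>t. t powr s * \<beta> t) has_real_derivative (t powr (s - 1) * \<gamma> t)) (at t)" for t
    proof (cases "t < \<tau>")
      case True
      then show ?thesis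
        using has_real_derivative_zero_below[of \<tau> "\<lambda>t. t powr s * \<beta> t" t] Suc.prems \<gamma> by auto
    next
      case False
      then have "t > 0" using \<open>\<tau> > 0\<close> by simp
      then have "t powr s = t powr (s - 1) * t"
        by (simp add: powr_mult_base[of t "s - 1"] mult.commute)
      then show ?thesis
        using \<open>t > 0\<close> by (auto intro!: derivative_eq_intros \<beta>' simp: \<gamma>_def algebra_simps)
    qed
    then show ?case
      using Suc.IH[OF \<gamma>(1) \<open>\<tau> > 0\<close> \<gamma>(2)]
      by (intro Ck_SucI[of _ "\<lambda>t. (*) (t powr (s - 1) * \<gamma> t)"]) (auto simp: has_field_derivative_def)
  qed
  then show ?thesis by (simp add: smooth_def)
qed

lemma smooth_antiderivative:
  fixes h :: "real \<Rightarrow> real"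
  assumes "smooth h"
  obtains H where "smooth H" "\<And>t. (H has_real_derivative h t) (at t)"
proof -
  have "isCont h t" for t
    using smooth_real_deriv(1)[OF assms] DERIV_isCont by blast
  then obtain H where "\<And>t. (H has_real_derivative h t) (at t)"
    using einterval_antiderivative[of "-\<infinity>" \<infinity> h]
    by (auto simp: has_real_derivative_iff_has_vector_derivative)
  then show ?thesis
    using that smooth_realI assms by blast
qed

section \<open>Flat functions and a smooth step\<close>

definition flat :: "nat \<Rightarrow> real \<Rightarrow> real" where
  "flat n t = (if t \<le> 0 then 0 else (1 / t) ^ n * exp (- (1 / t)))"

lemma flat_tendsto_0: "(flat n \<longlongrightarrow> 0) (at 0)"
proof -
  have "((\<lambda>t. (inverse t) ^ n / exp (inverse t)) \<longlongrightarrow> (0::real)) (at_right 0)"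
    by (rule filterlim_compose[OF tendsto_power_div_exp_0 filterlim_inverse_at_top_right])
  then have "(flat n \<longlongrightarrow> 0) (at_right 0)"
    by (rule Lim_transform_eventually)
      (auto simp: flat_def eventually_at_filter exp_minus divide_simps)
  moreover have "(flat n \<longlongrightarrow> 0) (at_left 0)"
    by (rule Lim_transform_eventually[OF tendsto_const])
      (auto simp: flat_def eventually_at_filter)
  ultimately show ?thesis
    using filterlim_split_at_real by (metis filterlim_split_at)
qed

text \<open>The powers of \<open>1 / t\<close> make the family closed under differentiation up to
  linear combinations, so smoothness follows by induction over all \<open>n\<close> at once. The
  delicate point is 0, where the difference quotient of \<open>flat n\<close> is
  \<open>flat (n + 1)\<close>, which tends to 0 because the exponential beats every power.\<close>

lemma flat_deriv: "(flat n has_real_derivative (flat (n + 2) t - real n * flat (n + 1) t)) (at t)"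
proof -
  consider "t < 0" | "t = 0" | "t > 0" by linarith
  then show ?thesis
  proof cases
    case 1
    then show ?thesis
      using has_real_derivative_zero_below[of 0 "flat n" t] by (simp add: flat_def)
  next
    case 2
    have "((\<lambda>h. flat n h / h) \<longlongrightarrow> 0) (at 0)"
      using flat_tendsto_0[of "n + 1"]
      by (rule Lim_transform_eventually) (auto simp: flat_def eventually_at_filter)
    then show ?thesis
      using 2 by (simp add: DERIV_def flat_def)
  next
    case 3
    have "((\<lambda>t. (1 / t) ^ n) has_real_derivative (- real n * (1 / t) ^ (n + 1))) (at t)"
    proof (cases n)
      case (Suc m)
      have "((\<lambda>t. 1 / t) has_real_derivative (- ((1 / t) ^ 2))) (at t)"
        using 3 by (auto intro!: derivative_eq_intros simp: power2_eq_square)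
      from DERIV_power_Suc[OF this, of m] show ?thesis
        by (simp add: Suc power2_eq_square left_diff_distrib distrib_right diff_divide_distrib add_divide_distrib)
    qed simp
    moreover have "((\<lambda>t. exp (- (1 / t))) has_real_derivative ((1 / t) ^ 2 * exp (- (1 / t)))) (at t)"
      using 3 by (auto intro!: derivative_eq_intros simp: power2_eq_square)
    ultimately have "((\<lambda>t. (1 / t) ^ n * exp (- (1 / t))) has_real_derivative
        (- real n * (1 / t) ^ (n + 1) * exp (- (1 / t))
          + (1 / t) ^ 2 * exp (- (1 / t)) * (1 / t) ^ n)) (at t)"
      by (rule DERIV_mult)
    moreover have "- real n * (1 / t) ^ (n + 1) * exp (- (1 / t))
          + (1 / t) ^ 2 * exp (- (1 / t)) * (1 / t) ^ n = flat (n + 2) t - real n * flat (n + 1) t"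
      using 3 by (simp add: flat_def power2_eq_square mult_ac)
    ultimately have "((\<lambda>t. (1 / t) ^ n * exp (- (1 / t))) has_real_derivative
        (flat (n + 2) t - real n * flat (n + 1) t)) (at t)"
      by simp
    then show ?thesis
      by (rule has_field_derivative_transform_within_open[where S = "{0<..}"])
        (use 3 in \<open>auto simp: flat_def\<close>)
  qed
qed

lemma smooth_flat: "smooth (flat n)"
proof -
  have "Ck k (flat n)" for k
  proof (induction k arbitrary: n)
    case 0
    then show ?case
      using DERIV_isCont[OF flat_deriv] by (auto intro!: continuous_at_imp_continuous_on)
  next
    case (Suc k)
    have "Ck k (\<lambda>t. flat (n + 2) t + (- real n) * flat (n + 1) t)"
      by (intro Ck_add Ck_mult Ck_const Suc)
    then show ?case
      using flat_deriv[of n]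
      by (intro Ck_SucI[of _ "\<lambda>t. (*) (flat (n + 2) t - real n * flat (n + 1) t)"])
        (auto simp: has_field_derivative_def)
  qed
  then show ?thesis by (simp add: smooth_def)
qed

text \<open>A product of two flat functions is a bump positive exactly on (1, 2); the step is its
  antiderivative, shifted and normalised by the total increase \<open>Z\<close>.\<close>

lemma smooth_step_exists:
  obtains \<theta> \<theta>' :: "real \<Rightarrow> real" where
    "smooth \<theta>" "smooth \<theta>'" "\<And>t. (\<theta> has_real_derivative \<theta>' t) (at t)" "\<And>t. \<theta>' t \<ge> 0"
    "\<And>t. t \<le> 1 \<Longrightarrow> \<theta> t = 0" "\<And>t. t \<ge> 2 \<Longrightarrow> \<theta> t = 1"
    "\<And>t. t \<le> 1 \<Longrightarrow> \<theta>' t = 0" "\<And>t. t \<ge> 2 \<Longrightarrow> \<theta>' t = 0"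
proof -
  define b where "b t = flat 0 (t - 1) * flat 0 (2 - t)" for t
  have "smooth b"
    unfolding b_def by (intro smooth_mult smooth_compose[OF smooth_flat] smooth_diff smooth_const
        smooth_ident)
  then obtain B where B: "smooth B" "\<And>t. (B has_real_derivative b t) (at t)"
    using smooth_antiderivative by blast
  have b: "b t \<ge> 0" "t \<le> 1 \<Longrightarrow> b t = 0" "t \<ge> 2 \<Longrightarrow> b t = 0" "1 < t \<Longrightarrow> t < 2 \<Longrightarrow> b t > 0" for t
    by (auto simp: b_def flat_def)
  have "B 1 < B 2"
    by (rule DERIV_pos_imp_increasing_open[of 1 2])
      (use B(2) b(4) in \<open>auto intro!: smooth_continuous_on B(1)\<close>)
  define Z where "Z = B 2 - B 1"
  have "Z > 0" using \<open>B 1 < B 2\<close> by (simp add: Z_def)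
  have const: "B s = B t" if "s \<le> t" "\<And>r. s \<le> r \<Longrightarrow> r \<le> t \<Longrightarrow> b r = 0" for s t
    by (rule antisym)
      (use that B(2) in \<open>auto intro!: DERIV_nonneg_imp_nondecreasing[of s t B]
        DERIV_nonpos_imp_nonincreasing[of s t B], (metis order_refl)+\<close>)
  show ?thesis
  proof (rule that[of "\<lambda>t. inverse Z * (B t - B 1)" "\<lambda>t. inverse Z * b t"])
    show "smooth (\<lambda>t. inverse Z * (B t - B 1))" "smooth (\<lambda>t. inverse Z * b t)"
      by (intro smooth_mult smooth_diff smooth_const B \<open>smooth b\<close>)+
    show "((\<lambda>t. inverse Z * (B t - B 1)) has_real_derivative inverse Z * b t) (at t)" for t
      by (auto intro!: derivative_eq_intros B)
    show "inverse Z * (B t - B 1) = 0" if "t \<le> 1" for t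
      using const[of t 1] that b by auto
    show "inverse Z * (B t - B 1) = 1" if "t \<ge> 2" for t
      using const[of 2 t] that b \<open>Z > 0\<close> by (auto simp: Z_def)
  qed (use b \<open>Z > 0\<close> in auto)
qed

section \<open>Integration of radial functions\<close>

lemma emeasure_homogeneous_sublevel:
  fixes \<rho> :: "'a::euclidean_space \<Rightarrow> real"
  assumes hom: "\<And>s x. s > 0 \<Longrightarrow> \<rho> (s *\<^sub>R x) = s * \<rho> x" and t: "t > 0"
    and meas: "\<rho> \<in> borel_measurable borel"
  shows "emeasure lborel {x. \<rho> x \<le> t} = ennreal (t ^ DIM('a)) * emeasure lborel {x. \<rho> x \<le> 1}"
proof -
  have set: "{x. \<rho> x \<le> t} = (\<lambda>x. t *\<^sub>R x + 0) ` {x. \<rho> x \<le> 1}"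
  proof (intro set_eqI iffI)
    fix x assume "x \<in> {x. \<rho> x \<le> t}"
    then have "\<rho> (inverse t *\<^sub>R x) \<le> 1"
      using t by (subst hom) (auto simp: field_simps)
    then show "x \<in> (\<lambda>x. t *\<^sub>R x + 0) ` {x. \<rho> x \<le> 1}"
      using t by (intro image_eqI[of _ _ "inverse t *\<^sub>R x"]) auto
  qed (use t hom in auto)
  have sets: "{x. \<rho> x \<le> s} \<in> sets borel" for s
    using meas by measurable
  have "emeasure lebesgue {x. \<rho> x \<le> t} = \<bar>t\<bar> ^ DIM('a) * emeasure lebesgue {x. \<rho> x \<le> 1}"
    unfolding set using emeasure_lebesgue_affine[of t 0 "{x. \<rho> x \<le> 1}"] by simp
  then show ?thesis
    using t sets by simp
qed

text \<open>This takes the place of polar coordinates. Scaling determines the image measure of every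
  half-line, and half-lines form an intersection-stable generator of the Borel sets.\<close>

lemma distr_homogeneous:
  fixes \<rho> :: "'a::euclidean_space \<Rightarrow> real"
  assumes hom: "\<And>s x. s > 0 \<Longrightarrow> \<rho> (s *\<^sub>R x) = s * \<rho> x"
    and pos: "\<And>x. x \<noteq> 0 \<Longrightarrow> \<rho> x > 0" and zero: "\<rho> 0 = 0"
    and meas[measurable]: "\<rho> \<in> borel_measurable borel"
    and fin: "emeasure lborel {x. \<rho> x \<le> 1} < \<infinity>"
  shows "distr lborel borel \<rho> = density lborel
    (\<lambda>r. ennreal (real DIM('a) * measure lborel {x. \<rho> x \<le> 1} * r ^ (DIM('a) - 1) * indicator {0..} r))"
    (is "?M = ?D")
proof -
  define v where "v = measure lborel {x. \<rho> x \<le> 1}"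
  define n where "n = DIM('a)"
  have v: "emeasure lborel {x. \<rho> x \<le> 1} = ennreal v" "v \<ge> 0"
    using fin by (auto simp: v_def emeasure_eq_ennreal_measure)
  have "n > 0" by (simp add: n_def)
  have eqM: "emeasure ?M {..t} = (if t \<le> 0 then 0 else ennreal (v * t ^ n))" for t
  proof -
    have "emeasure ?M {..t} = emeasure lborel {x. \<rho> x \<le> t}"
      by (subst emeasure_distr) (auto simp: vimage_def)
    also have "\<dots> = (if t \<le> 0 then 0 else ennreal (v * t ^ n))"
    proof (cases "t \<le> 0")
      case True
      then have "{x. \<rho> x \<le> t} \<subseteq> {0}"
        using pos by force
      then show ?thesis
        using True emeasure_mono[of "{x. \<rho> x \<le> t}" "{0}" lborel] by simp
    next
      case False
      then show ?thesis
        using emeasure_homogeneous_sublevel[OF hom, of t] v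
        by (simp add: n_def ennreal_mult'[symmetric] mult.commute)
    qed
    finally show ?thesis .
  qed
  have eqD: "emeasure ?D {..t} = (if t \<le> 0 then 0 else ennreal (v * t ^ n))" for t
  proof -
    have "emeasure ?D {..t} =
        (\<integral>\<^sup>+r. ennreal (real n * v * r ^ (n - 1) * indicator {0..} r) * indicator {..t} r \<partial>lborel)"
      by (subst emeasure_density) (auto simp: n_def v_def)
    also have "\<dots> = (\<integral>\<^sup>+r. ennreal (real n * v * r ^ (n - 1)) * indicator {0..t} r \<partial>lborel)"
      by (intro nn_integral_cong) (auto split: split_indicator)
    also have "\<dots> = (if t \<le> 0 then 0 else ennreal (v * t ^ n))"
    proof (cases "t < 0")
      case False
      have "(\<integral>\<^sup>+r. ennreal (real n * v * r ^ (n - 1)) * indicator {0..t} r \<partial>lborel)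
          = ennreal (v * t ^ n - v * 0 ^ n)"
        using False v
        by (intro nn_integral_FTC_Icc) (auto intro!: derivative_eq_intros)
      then show ?thesis
        using False \<open>n > 0\<close> by (auto simp: power_0_left)
    qed auto
    finally show ?thesis .
  qed
  show ?thesis
  proof (rule measure_eqI_generator_eq[where E = "range atMost" and \<Omega> = UNIV and A = "\<lambda>i. {..real i}"])
    show "Int_stable (range atMost :: real set set)"
      by (auto simp: Int_stable_def)
    show "sets ?M = sigma_sets UNIV (range atMost)" "sets ?D = sigma_sets UNIV (range atMost)"
      by (auto simp: borel_eq_atMost)
    show "emeasure ?M X = emeasure ?D X" if "X \<in> range atMost" for X
      using that eqM eqD by auto
    show "(\<Union>i. {..real i}) = UNIV"
      by (auto simp: real_arch_simple)
    show "emeasure ?M {..real i} \<noteq> \<infinity>" for i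
      unfolding eqM by auto
  qed auto
qed

text \<open>With n the dimension, the image of Lebesgue measure under \<open>\<rho>\<^sup>2\<close>
  has a density proportional to \<open>t powr (n / 2 - 1)\<close>. The weight cancels it exactly and
  leaves a one-dimensional integral of \<open>f\<close>, evaluated by its antiderivative.\<close>

lemma radial_integral:
  fixes \<rho> :: "'a::euclidean_space \<Rightarrow> real"
  assumes hom: "\<And>s x. s > 0 \<Longrightarrow> \<rho> (s *\<^sub>R x) = s * \<rho> x"
    and pos: "\<And>x. x \<noteq> 0 \<Longrightarrow> \<rho> x > 0" and zero: "\<rho> 0 = 0"
    and meas[measurable]: "\<rho> \<in> borel_measurable borel"
    and fin: "emeasure lborel {x. \<rho> x \<le> 1} < \<infinity>"
    and cd: "0 < c" "c \<le> d"
    and F: "\<And>t. c \<le> t \<Longrightarrow> t \<le> d \<Longrightarrow> (F has_real_derivative f t) (at t)"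
    and f: "\<And>t. c \<le> t \<Longrightarrow> t \<le> d \<Longrightarrow> isCont f t"
  shows "has_bochner_integral lborel
    (\<lambda>x. (\<rho> x)\<^sup>2 powr (1 - real DIM('a) / 2) * (f ((\<rho> x)\<^sup>2) * indicator {c..d} ((\<rho> x)\<^sup>2)))
    (real DIM('a) * measure lborel {x. \<rho> x \<le> 1} / 2 * (F d - F c))"
proof -
  define v where "v = measure lborel {x. \<rho> x \<le> 1}"
  define n where "n = DIM('a)"
  have n: "n > 0" by (simp add: n_def)
  have v: "v \<ge> 0" by (simp add: v_def)
  define g where "g r = r\<^sup>2 powr (1 - real n / 2) * (f (r\<^sup>2) * indicator {c..d} (r\<^sup>2))" for r :: real
  have "continuous_on {c..d} f"
    using f by (auto intro!: continuous_at_imp_continuous_on)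
  then have [measurable]: "(\<lambda>t. f t * indicator {c..d} t) \<in> borel_measurable borel"
    using borel_measurable_continuous_on_indicator[of "{c..d}" f] by (simp add: mult.commute)
  have [measurable]: "g \<in> borel_measurable borel"
    unfolding g_def[abs_def] by measurable
  have "has_bochner_integral lborel (\<lambda>r. (real n * v * r * f (r\<^sup>2)) * indicator {sqrt c..sqrt d} r)
      (real n * v / 2 * F ((sqrt d)\<^sup>2) - real n * v / 2 * F ((sqrt c)\<^sup>2))"
  proof (rule has_bochner_integral_FTC_Icc_real)
    show "sqrt c \<le> sqrt d" using cd by simp
    fix r assume "sqrt c \<le> r" "r \<le> sqrt d"
    moreover from this have "r > 0"
      using cd real_sqrt_gt_zero[of c] by linarith
    ultimately have r: "c \<le> r\<^sup>2" "r\<^sup>2 \<le> d"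
      using cd power_mono[of "sqrt c" r 2] power_mono[of r "sqrt d" 2] by auto
    have "((\<lambda>r. F (r\<^sup>2)) has_real_derivative f (r\<^sup>2) * (2 * r)) (at r)"
      by (rule DERIV_chain2[where f = F and g = "\<lambda>r. r\<^sup>2", OF F[OF r]]) (auto intro!: derivative_eq_intros)
    then show "((\<lambda>r. real n * v / 2 * F (r\<^sup>2)) has_real_derivative (real n * v * r * f (r\<^sup>2))) (at r)"
      by (auto intro!: derivative_eq_intros)
    show "isCont (\<lambda>r. real n * v * r * f (r\<^sup>2)) r"
      by (intro continuous_intros isCont_o2[where g = f and f = "\<lambda>r. r\<^sup>2", OF _ f[OF r]])
  qed
  moreover have "(real n * v * r * f (r\<^sup>2)) * indicator {sqrt c..sqrt d} r
      = (real n * v * r ^ (n - 1) * indicator {0..} r) *\<^sub>R g r" for r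
  proof (cases "r > 0")
    case True
    have "r\<^sup>2 powr (1 - real n / 2) = (r powr 2) powr (1 - real n / 2)"
      using True by (simp add: powr_numeral)
    also have "\<dots> = r powr (2 - real n)"
      by (simp add: powr_powr right_diff_distrib)
    finally have 1: "r\<^sup>2 powr (1 - real n / 2) = r powr (2 - real n)" .
    have "r ^ (n - 1) * r powr (2 - real n) = r powr (real n - 1) * r powr (2 - real n)"
      using True n powr_realpow[of r "n - 1"] by (simp add: of_nat_diff)
    also have "\<dots> = r powr (real n - 1 + (2 - real n))"
      by (rule powr_add[symmetric])
    also have "\<dots> = r"
      using True by simp
    finally have 2: "r ^ (n - 1) * r powr (2 - real n) = r" .
    have 3: "indicator {c..d} (r\<^sup>2) = (indicator {sqrt c..sqrt d} r :: real)"
      using True real_sqrt_le_iff[of c "r\<^sup>2"] real_sqrt_le_iff[of "r\<^sup>2" d]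
      by (simp add: indicator_def)
    have "(real n * v * r ^ (n - 1) * indicator {0..} r) *\<^sub>R g r
        = real n * v * (r ^ (n - 1) * r powr (2 - real n)) * f (r\<^sup>2) * indicator {sqrt c..sqrt d} r"
      using True by (simp add: g_def 1 3 mult.assoc)
    then show ?thesis by (simp only: 2)
  next
    case False
    then have "indicator {sqrt c..sqrt d} r = (0::real)"
      using order.strict_trans2[OF real_sqrt_gt_zero[OF cd(1)], of r] by (auto simp: indicator_def)
    moreover have "indicator {0..} r *\<^sub>R g r = 0"
      using False cd by (cases "r = 0") (auto simp: g_def)
    ultimately show ?thesis by auto
  qed
  ultimately have "has_bochner_integral lborel
      (\<lambda>r. (real n * v * r ^ (n - 1) * indicator {0..} r) *\<^sub>R g r) (real n * v / 2 * (F d - F c))"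
    using cd by (simp add: right_diff_distrib)
  then have "has_bochner_integral (density lborel
        (\<lambda>r. ennreal (real n * v * r ^ (n - 1) * indicator {0..} r))) g (real n * v / 2 * (F d - F c))"
    using v by (intro has_bochner_integral_density) (auto split: split_indicator)
  then have "has_bochner_integral (distr lborel borel \<rho>) g (real n * v / 2 * (F d - F c))"
    using distr_homogeneous[OF hom pos zero meas fin] by (simp add: v_def n_def)
  then have "has_bochner_integral lborel (\<lambda>x. g (\<rho> x)) (real n * v / 2 * (F d - F c))"
    by (simp add: has_bochner_integral_iff integrable_distr_eq integral_distr)
  then show ?thesis
    by (simp add: g_def n_def v_def)
qed

section \<open>Integrability against compactly supported factors\<close>

lemma set_integrable_mult_bounded:
  fixes w f :: "'a::euclidean_space \<Rightarrow> real"
  assumes "set_integrable lborel K w" "f \<in> borel_measurable borel"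
    and "\<And>x. \<bar>f x\<bar> \<le> B" "\<And>x. x \<notin> K \<Longrightarrow> f x = 0"
  shows "integrable lborel (\<lambda>x. w x * f x)"
proof -
  have w: "integrable lborel (\<lambda>x. indicator K x * w x)"
    using assms(1) by (simp add: set_integrable_def)
  have eq: "w x * f x = (indicator K x * w x) * f x" for x
    using assms(4)[of x] by (auto simp: indicator_def)
  have "B \<ge> 0" using assms(3)[of undefined] by linarith
  show ?thesis
    unfolding eq
  proof (rule Bochner_Integration.integrable_bound[OF integrable_mult_right[OF w, of B]])
    show "AE x in lborel. norm (indicator K x * w x * f x) \<le> norm (B * (indicator K x * w x))"
    proof (rule AE_I2)
      show "norm (indicator K x * w x * f x) \<le> norm (B * (indicator K x * w x))" for x
        using mult_left_mono[OF assms(3)[of x], of "\<bar>indicator K x * w x\<bar>"] \<open>B \<ge> 0\<close>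
        by (simp add: abs_mult mult.commute)
    qed
    show "(\<lambda>x. indicator K x * w x * f x) \<in> borel_measurable lborel"
      using borel_measurable_integrable[OF w] assms(2) by measurable
  qed
qed

lemma bounded_of_continuous_compact_support:
  fixes f :: "'a::euclidean_space \<Rightarrow> real"
  assumes "continuous_on UNIV f" "compact K" "\<And>x. x \<notin> K \<Longrightarrow> f x = 0"
  obtains B where "\<And>x. \<bar>f x\<bar> \<le> B"
proof -
  have "bounded (f ` K)"
    using assms continuous_on_subset compact_continuous_image compact_imp_bounded by blast
  then obtain B where B: "\<And>x. x \<in> K \<Longrightarrow> \<bar>f x\<bar> \<le> B" by (auto simp: bounded_iff)
  have "\<bar>f x\<bar> \<le> max B 0" for x
    using B[of x] assms(3)[of x] by (cases "x \<in> K") auto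
  then show ?thesis by (rule that)
qed

lemma integrable_mult_compact_support:
  fixes w f :: "'a::euclidean_space \<Rightarrow> real"
  assumes "set_integrable lborel K w" "compact K" "continuous_on UNIV f" "\<And>x. x \<notin> K \<Longrightarrow> f x = 0"
  shows "integrable lborel (\<lambda>x. w x * f x)"
proof -
  obtain B where "\<And>x. \<bar>f x\<bar> \<le> B"
    using bounded_of_continuous_compact_support[OF assms(3,2,4)] by blast
  then show ?thesis
    by (rule set_integrable_mult_bounded[OF assms(1) borel_measurable_continuous_onI[OF assms(3)] _ assms(4)])
qed

lemma set_integrable_one_compact:
  fixes K :: "'a::euclidean_space set"
  assumes "compact K"
  shows "set_integrable lborel K (\<lambda>x. 1::real)"
proof -
  have "K \<in> sets lborel" "emeasure lborel K < \<infinity>"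
    using assms emeasure_bounded_finite[OF compact_imp_bounded[OF assms]] by (auto simp: borel_compact)
  then show ?thesis
    using integrable_real_indicator by (auto simp: set_integrable_def)
qed

text \<open>Compact sets have finite measure, and
  \<open>\<bar>y\<bar> \<le> 1 + y\<^sup>2\<close>.\<close>

lemma L2_loc_imp_set_integrable:
  assumes "L2_loc f" "compact K"
  shows "set_integrable lborel K f"
proof -
  have K: "K \<in> sets borel" using assms(2) by (simp add: borel_compact)
  have f: "f \<in> borel_measurable borel" using assms(1) by (simp add: L2_loc_def)
  have 1: "set_integrable lborel K (\<lambda>x. (f x)\<^sup>2)" using assms by (simp add: L2_loc_def)
  have 2: "set_integrable lborel K (\<lambda>x. 1::real)"
    using assms(2) by (rule set_integrable_one_compact)
  have *: "\<bar>y\<bar> \<le> \<bar>1 + y\<^sup>2\<bar>" for y :: real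
    using zero_le_power2[of "\<bar>y\<bar> - 1"] by (simp add: power2_diff)
  show ?thesis
    by (rule set_integrable_bound[OF set_integral_add(1)[OF 2 1]])
      (use * f K in \<open>auto simp: set_borel_measurable_def\<close>)
qed

section \<open>The dual norm\<close>

text \<open>Euler's relation: the derivative of \<open>f (s *\<^sub>R x)\<close> at
  \<open>s = 1\<close> is computed once by the chain rule and once from homogeneity.\<close>

lemma Fgrad_inner_self_homogeneous:
  assumes "f differentiable (at x)" "\<And>s. s > 0 \<Longrightarrow> f (s *\<^sub>R x) = s * f x"
  shows "Fgrad f x \<bullet> x = f x"
proof -
  have "((\<lambda>s. f (s *\<^sub>R x)) has_derivative (\<lambda>h. Fgrad f x \<bullet> (h *\<^sub>R x))) (at 1)"
    by (rule has_derivative_compose[of "\<lambda>s. s *\<^sub>R x" "\<lambda>h. h *\<^sub>R x" 1 UNIV f, simplified])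
      (auto intro!: derivative_eq_intros Fgrad_has_derivative assms)
  then have "((\<lambda>s. f (s *\<^sub>R x)) has_real_derivative (Fgrad f x \<bullet> x)) (at 1)"
    by (simp add: has_field_derivative_def mult.commute[of _ "Fgrad f x \<bullet> x"])
  moreover have "((\<lambda>s. f (s *\<^sub>R x)) has_real_derivative f x) (at 1)"
    by (rule has_field_derivative_transform_within_open[of "\<lambda>s. s * f x" _ _ "{0<..}"])
      (auto intro!: derivative_eq_intros simp: assms)
  ultimately show ?thesis by (rule DERIV_unique)
qed

text \<open>Applied to \<open>F\<close> at the origin. A differentiable minimum is critical, and
  otherwise \<open>Fgrad\<close> is 0 by default, so both cases agree.\<close>

lemma Fgrad_zero_at_min:
  assumes "\<And>y. f y \<ge> f x"
  shows "Fgrad f x = 0"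
proof (cases "f differentiable (at x)")
  case True
  have "(\<lambda>h. Fgrad f x \<bullet> h) = (\<lambda>h. 0)"
    by (rule has_derivative_local_min[OF Fgrad_has_derivative[OF True]]) (simp add: assms)
  then show ?thesis by (metis inner_eq_zero_iff)
qed (simp add: Fgrad_def)

locale finsler_norm =
  fixes F :: "'a::euclidean_space \<Rightarrow> real" and a b :: real
  assumes C2: "C2_on (UNIV - {0}) F"
    and hom: "\<And>t \<xi>. F (t *\<^sub>R \<xi>) = \<bar>t\<bar> * F \<xi>"
    and ab: "0 < a" "a \<le> b" "\<And>\<xi>. a * norm \<xi> \<le> F \<xi>" "\<And>\<xi>. F \<xi> \<le> b * norm \<xi>"
    and dual: "\<And>x y. x \<noteq> 0 \<Longrightarrow> y \<noteq> 0 \<Longrightarrow>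
         Fgrad F x \<bullet> Fgrad (Fdual F) y = (x \<bullet> y) / (F x * Fdual F y)"
begin

abbreviation \<rho> :: "'a \<Rightarrow> real" where "\<rho> \<equiv> Fdual F"

text \<open>The gradient of \<open>\<rho>\<^sup>2 / 2\<close>. The factor \<open>\<rho> y\<close>
  makes it vanish at 0 whatever \<open>Fgrad\<close> gives there.\<close>

definition L :: "'a \<Rightarrow> 'a" where "L y = \<rho> y *\<^sub>R Fgrad \<rho> y"

definition q :: "'a \<Rightarrow> real" where "q x = (\<rho> x)\<^sup>2"

lemma F_nonneg: "F \<xi> \<ge> 0"
  using ab(3)[of \<xi>] ab(1) by (meson order_trans mult_nonneg_nonneg norm_ge_zero less_imp_le)

lemma F_zero: "F 0 = 0"
  using hom[of 0 0] by simp

lemma F_pos: "\<xi> \<noteq> 0 \<Longrightarrow> F \<xi> > 0"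
  using ab(3)[of \<xi>] ab(1) by (smt (verit) mult_pos_pos zero_less_norm_iff)

lemma dual_set_bound:
  assumes "F \<xi> < 1"
  shows "x \<bullet> \<xi> \<le> norm x / a"
proof -
  have "a * norm \<xi> \<le> 1" using ab(3)[of \<xi>] assms by linarith
  then have "norm \<xi> \<le> 1 / a" using ab(1) by (simp add: field_simps)
  then show ?thesis
    using norm_cauchy_schwarz[of x \<xi>] mult_left_mono[of "norm \<xi>" "1 / a" "norm x"] by simp
qed

lemma dual_bdd: "bdd_above {x \<bullet> \<xi> | \<xi>. F \<xi> < 1}"
  using dual_set_bound by (auto intro!: bdd_aboveI)

lemma rho_upper: "\<rho> x \<le> norm x / a"
  unfolding Fdual_def
  by (rule cSup_least) (use dual_set_bound F_zero in \<open>auto intro!: exI[of _ 0]\<close>)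

lemma rho_ge: "F \<xi> < 1 \<Longrightarrow> x \<bullet> \<xi> \<le> \<rho> x"
  unfolding Fdual_def by (rule cSup_upper[OF _ dual_bdd]) auto

lemma rho_lower: "norm x / (2 * b) \<le> \<rho> x"
proof (cases "x = 0")
  case True
  then show ?thesis using rho_ge[of 0 0] F_zero by simp
next
  case False
  have b: "b > 0" using ab by linarith
  \<comment> \<open>The supremum in \<open>Fdual\<close> runs over the strict inequality
    \<open>F \<xi> < 1\<close>; the 2 puts the test vector strictly inside, at the cost of the
    factor 2 in the bound.\<close>
  let ?c = "1 / (2 * b * norm x)"
  have "F (?c *\<^sub>R x) = ?c * F x"
    using b by (simp add: hom)
  also have "\<dots> \<le> ?c * (b * norm x)"
    using b ab(4)[of x] by (intro mult_left_mono) auto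
  also have "\<dots> < 1" using b False by simp
  finally have "x \<bullet> (?c *\<^sub>R x) \<le> \<rho> x" by (rule rho_ge)
  moreover have "x \<bullet> (?c *\<^sub>R x) = norm x / (2 * b)"
    using False by (simp add: dot_square_norm power2_eq_square)
  ultimately show ?thesis by simp
qed

lemma rho_zero: "\<rho> 0 = 0"
  using rho_upper[of 0] rho_lower[of 0] by simp

lemma rho_pos: "x \<noteq> 0 \<Longrightarrow> \<rho> x > 0"
  using rho_lower[of x] ab by (smt (verit) divide_pos_pos zero_less_norm_iff)

lemma rho_nonneg: "\<rho> x \<ge> 0"
  using rho_pos[of x] rho_zero by (cases "x = 0") auto

text \<open>Pulling \<open>s\<close> out of the inner product gives one inequality for every
  positive factor; using it with \<open>inverse s\<close> gives the other.\<close>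

lemma rho_hom:
  assumes "s > 0"
  shows "\<rho> (s *\<^sub>R x) = s * \<rho> x"
proof -
  have le: "\<rho> (s *\<^sub>R x) \<le> s * \<rho> x" if "s > 0" for s x
    unfolding Fdual_def[of F "s *\<^sub>R x"]
    by (rule cSup_least) (use F_zero that in \<open>auto intro!: exI[of _ 0] rho_ge\<close>)
  have "\<rho> (inverse s *\<^sub>R (s *\<^sub>R x)) \<le> inverse s * \<rho> (s *\<^sub>R x)"
    using assms by (intro le) auto
  then show ?thesis
    using le[of s x] assms by (auto simp: field_simps)
qed

lemma F_diff: "\<xi> \<noteq> 0 \<Longrightarrow> F differentiable (at \<xi>)"
  and Fgrad_diff: "\<xi> \<noteq> 0 \<Longrightarrow> i \<in> Basis \<Longrightarrow> (\<lambda>y. Fgrad F y \<bullet> i) differentiable (at \<xi>)"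
  using C2 by (auto simp: C2_on_def)

text \<open>Differentiability of the dual norm is extracted from the duality identity: where it
  failed, \<open>Fgrad \<rho> y\<close> would be 0 by default, yet the identity with both points
  equal to \<open>y\<close> has a positive right-hand side.\<close>

lemma rho_diff:
  assumes "y \<noteq> 0"
  shows "\<rho> differentiable (at y)"
proof (rule ccontr)
  assume "\<not> ?thesis"
  then have "Fgrad \<rho> y = 0" by (simp add: Fgrad_def)
  then have "(y \<bullet> y) / (F y * \<rho> y) = 0"
    using dual[OF assms assms] by simp
  then show False
    using assms F_pos[OF assms] rho_pos[OF assms] by auto
qed

lemma F_self: "\<xi> \<noteq> 0 \<Longrightarrow> Fgrad F \<xi> \<bullet> \<xi> = F \<xi>"
  by (rule Fgrad_inner_self_homogeneous) (auto simp: F_diff hom)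

text \<open>Clearing denominators absorbs the zero vectors, so the identity holds for all pairs; it
  can then be compared in \<open>y\<close> and differentiated in \<open>\<xi>\<close>.\<close>

lemma duality: "F \<xi> * (Fgrad F \<xi> \<bullet> L y) = \<xi> \<bullet> y"
  using dual[of \<xi> y] F_pos[of \<xi>] rho_pos[of y] F_zero rho_zero
  by (cases "\<xi> = 0 \<or> y = 0") (auto simp: L_def)

text \<open>The right-hand side of \<open>duality\<close> is linear in \<open>y\<close>, and the
  vectors \<open>F \<xi> *\<^sub>R Fgrad F \<xi>\<close> separate points, so \<open>L\<close>
  inherits linearity.\<close>

lemma dual_map_linear: "linear L"
proof
  \<comment> \<open>Testing with \<open>\<xi> = v\<close> gives \<open>(F v)\<^sup>2\<close> by
    Euler's relation, which is positive unless \<open>v\<close> is 0.\<close>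
  have eq: "v = 0" if "\<And>\<xi>. F \<xi> * (Fgrad F \<xi> \<bullet> v) = 0" for v
    using that[of v] F_self[of v] F_pos[of v] by force
  show "L (x + y) = L x + L y" for x y
    using eq[of "L (x + y) - (L x + L y)"]
    by (simp add: inner_diff_right inner_add_right right_diff_distrib distrib_left duality)
  show "L (c *\<^sub>R x) = c *\<^sub>R L x" for c x
    using eq[of "L (c *\<^sub>R x) - c *\<^sub>R L x"]
    by (simp add: inner_diff_right right_diff_distrib duality mult.left_commute[of _ c])
qed

lemma L_zero: "L 0 = 0"
  by (simp add: L_def rho_zero)

lemma L_self: "L x \<bullet> x = q x"
  using Fgrad_inner_self_homogeneous[OF rho_diff rho_hom, of x] rho_zero
  by (cases "x = 0") (auto simp: L_def q_def power2_eq_square)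

lemma q_nonneg: "q x \<ge> 0" by (simp add: q_def)

lemma q_pos: "x \<noteq> 0 \<Longrightarrow> q x > 0"
  using rho_pos[of x] by (simp add: q_def)

lemma q_zero: "q 0 = 0" by (simp add: q_def rho_zero)

lemma q_deriv: "(q has_derivative (\<lambda>h. 2 * (L x \<bullet> h))) (at x)"
proof (cases "x = 0")
  case False
  show ?thesis
    unfolding q_def[abs_def]
    by (rule derivative_eq_intros Fgrad_has_derivative rho_diff False refl)+
      (auto simp: L_def)
next
  case True
  \<comment> \<open>At 0 the chain rule through \<open>\<rho>\<close> breaks down; there
    \<open>q\<close> is differentiated as the quadratic form \<open>L x \<bullet> x\<close>.\<close>
  have bl: "bounded_linear L"
    using dual_map_linear by (simp add: linear_conv_bounded_linear)
  have "q = (\<lambda>x. L x \<bullet> x)" using L_self by auto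
  moreover have "((\<lambda>x. L x \<bullet> x) has_derivative (\<lambda>h. 2 * (L x \<bullet> h))) (at x)"
    by (rule derivative_eq_intros bounded_linear_imp_has_derivative[OF bl] refl)+
      (auto simp: True L_zero)
  ultimately show ?thesis by simp
qed

lemma smooth_q: "smooth q"
  by (rule smoothI[OF q_deriv])
    (intro smooth_linear bounded_linear_const_mult bounded_linear_inner_left_comp
      dual_map_linear[unfolded linear_conv_bounded_linear])

lemma continuous_q: "continuous_on A q"
  using smooth_q by (rule smooth_continuous_on)

lemma rho_eq_sqrt: "\<rho> = (\<lambda>x. sqrt (q x))"
  using rho_nonneg by (auto simp: q_def)

lemma rho_measurable[measurable]: "\<rho> \<in> borel_measurable borel"
  unfolding rho_eq_sqrt
  by (intro borel_measurable_continuous_onI continuous_intros continuous_q)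

lemma norm_le_of_q: "q x \<le> c \<Longrightarrow> norm x \<le> 2 * b * sqrt c"
proof -
  assume "q x \<le> c"
  then have "\<rho> x \<le> sqrt c" by (simp add: rho_eq_sqrt)
  then have "norm x / (2 * b) \<le> sqrt c" using rho_lower[of x] by linarith
  then show ?thesis using ab by (simp add: field_simps)
qed

lemma q_le_norm: "q x \<le> (norm x / a)\<^sup>2"
  unfolding q_def using rho_upper rho_nonneg by (intro power_mono)

lemma compact_sublevel: "compact {x. q x \<le> c}"
proof -
  have "bounded {x. q x \<le> c}"
    using norm_le_of_q by (auto simp: bounded_iff)
  moreover have "closed {x. q x \<le> c}"
    by (intro closed_Collect_le continuous_intros continuous_q)
  ultimately show ?thesis by (simp add: compact_eq_bounded_closed)
qed

lemma sublevel_measure: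
  "emeasure lborel {x. \<rho> x \<le> 1} < \<infinity>" "measure lborel {x. \<rho> x \<le> 1} > 0"
proof -
  have eq: "{x. \<rho> x \<le> 1} = {x. q x \<le> 1}"
    by (simp add: rho_eq_sqrt)
  show fin: "emeasure lborel {x. \<rho> x \<le> 1} < \<infinity>"
    unfolding eq by (intro emeasure_bounded_finite compact_imp_bounded compact_sublevel)
  have "ball 0 a \<subseteq> {x. \<rho> x \<le> 1}"
  proof
    fix x :: 'a assume "x \<in> ball 0 a"
    then have "norm x / a \<le> 1" using ab(1) by simp
    then show "x \<in> {x. \<rho> x \<le> 1}" using rho_upper[of x] by simp
  qed
  then have "measure lborel (ball (0::'a) a) \<le> measure lborel {x. \<rho> x \<le> 1}"
    using fin by (intro measure_mono_fmeasurable) (auto simp: fmeasurable_def)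
  moreover have "measure lborel (ball (0::'a) a) > 0"
    using content_ball_pos[OF ab(1), of "0::'a"] .
  ultimately show "measure lborel {x. \<rho> x \<le> 1} > 0" by linarith
qed

lemma radial_has_derivative:
  assumes "(g has_real_derivative d) (at (q x))"
  shows "((\<lambda>x. g (q x)) has_derivative (\<lambda>h. 2 * d * (L x \<bullet> h))) (at x)"
  using has_derivative_compose[OF q_deriv assms[unfolded has_field_derivative_def]]
  by (simp add: mult_ac)

text \<open>The double sum is the Hessian of \<open>F\<^sup>2 / 2\<close> at \<open>\<xi>\<close>,
  applied twice to \<open>L y\<close>. By \<open>duality\<close> the gradient paired with
  \<open>L y\<close> is linear in \<open>\<xi>\<close>; differentiating shows that the Hessian sends
  \<open>L y\<close> to \<open>y\<close>. The value is therefore \<open>L y \<bullet> y\<close>,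
  whatever \<open>\<xi>\<close> is.\<close>

lemma hessian_identity:
  assumes "\<xi> \<noteq> 0"
  shows "(\<Sum>i\<in>Basis. \<Sum>j\<in>Basis. (Fgrad F \<xi> \<bullet> i) * (Fgrad F \<xi> \<bullet> j) * (L y \<bullet> i) * (L y \<bullet> j)
           + F \<xi> * hess F \<xi> i j * (L y \<bullet> i) * (L y \<bullet> j)) = q y"
proof -
  \<comment> \<open>The derivative of \<open>duality\<close> with respect to \<open>\<xi>\<close> in
    the direction \<open>j\<close>, computed on both sides.\<close>
  have key: "(\<Sum>i\<in>Basis. (Fgrad F \<xi> \<bullet> i) * (Fgrad F \<xi> \<bullet> j) * (L y \<bullet> i)
           + F \<xi> * hess F \<xi> i j * (L y \<bullet> i)) = j \<bullet> y" for j
  proof -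
    have D: "((\<lambda>\<eta>. Fgrad F \<eta> \<bullet> i) has_derivative frechet_derivative (\<lambda>\<eta>. Fgrad F \<eta> \<bullet> i) (at \<xi>)) (at \<xi>)"
      if "i \<in> Basis" for i
      using Fgrad_diff[OF assms that] by (simp add: frechet_derivative_works)
    have "((\<lambda>\<eta>. \<Sum>i\<in>Basis. F \<eta> * (Fgrad F \<eta> \<bullet> i) * (L y \<bullet> i)) has_derivative
       (\<lambda>h. \<Sum>i\<in>Basis. (F \<xi> * frechet_derivative (\<lambda>\<eta>. Fgrad F \<eta> \<bullet> i) (at \<xi>) h
            + (Fgrad F \<xi> \<bullet> h) * (Fgrad F \<xi> \<bullet> i)) * (L y \<bullet> i))) (at \<xi>)"
      by (intro has_derivative_sum has_derivative_mult_left has_derivative_mult D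
          Fgrad_has_derivative F_diff assms)
    moreover have "(\<lambda>\<eta>. \<Sum>i\<in>Basis. F \<eta> * (Fgrad F \<eta> \<bullet> i) * (L y \<bullet> i)) = (\<lambda>\<eta>. \<eta> \<bullet> y)"
    proof
      fix \<eta>
      have "(\<Sum>i\<in>Basis. F \<eta> * (Fgrad F \<eta> \<bullet> i) * (L y \<bullet> i)) = F \<eta> * (Fgrad F \<eta> \<bullet> L y)"
        by (simp add: euclidean_inner[of "Fgrad F \<eta>" "L y"] sum_distrib_left mult.assoc)
      then show "(\<Sum>i\<in>Basis. F \<eta> * (Fgrad F \<eta> \<bullet> i) * (L y \<bullet> i)) = \<eta> \<bullet> y"
        by (simp add: duality)
    qed
    ultimately have 1: "((\<lambda>\<eta>. \<eta> \<bullet> y) has_derivative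
       (\<lambda>h. \<Sum>i\<in>Basis. (F \<xi> * frechet_derivative (\<lambda>\<eta>. Fgrad F \<eta> \<bullet> i) (at \<xi>) h
            + (Fgrad F \<xi> \<bullet> h) * (Fgrad F \<xi> \<bullet> i)) * (L y \<bullet> i))) (at \<xi>)"
      by simp
    have 2: "((\<lambda>\<eta>. \<eta> \<bullet> y) has_derivative (\<lambda>h. h \<bullet> y)) (at \<xi>)"
      by (auto intro!: derivative_eq_intros)
    show ?thesis
      using fun_cong[OF has_derivative_unique[OF 1 2], of j]
      by (simp add: hess_def Defs.pderiv_def algebra_simps)
  qed
  have "(\<Sum>i\<in>Basis. \<Sum>j\<in>Basis. (Fgrad F \<xi> \<bullet> i) * (Fgrad F \<xi> \<bullet> j) * (L y \<bullet> i) * (L y \<bullet> j)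
           + F \<xi> * hess F \<xi> i j * (L y \<bullet> i) * (L y \<bullet> j))
      = (\<Sum>j\<in>Basis. (\<Sum>i\<in>Basis. (Fgrad F \<xi> \<bullet> i) * (Fgrad F \<xi> \<bullet> j) * (L y \<bullet> i)
           + F \<xi> * hess F \<xi> i j * (L y \<bullet> i)) * (L y \<bullet> j))"
    by (subst sum.swap) (simp add: sum_distrib_right distrib_right)
  also have "\<dots> = (\<Sum>j\<in>Basis. (L y \<bullet> j) * (y \<bullet> j))"
    unfolding key by (simp add: mult.commute inner_commute)
  also have "\<dots> = q y"
    by (simp add: L_self flip: euclidean_inner)
  finally show ?thesis .
qed

end

section \<open>Stable solutions and radial test functions\<close>

locale stable_solution = finsler_norm F a b
  for F :: "'a::euclidean_space \<Rightarrow> real" and a b :: real +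
  fixes \<alpha> :: real and u :: "'a \<Rightarrow> real" and G :: "'a \<Rightarrow> 'a" and S :: "'a set"
  assumes sol: "weak_sol_grad F \<alpha> u G"
    and compact_S: "compact S"
    and stable: "\<And>\<phi>. test_fun_on (- S) \<phi> \<Longrightarrow>
        (\<integral>x. (\<Sum>i\<in>Basis. \<Sum>j\<in>Basis.
               (Fgrad F (G x) \<bullet> i) * (Fgrad F (G x) \<bullet> j) * pderiv \<phi> i x * pderiv \<phi> j x
             + F (G x) * hess F (G x) i j * pderiv \<phi> i x * pderiv \<phi> j x)
           - Fdual F x powr \<alpha> * exp (u x) * (\<phi> x)\<^sup>2 \<partial>lborel) \<ge> 0"
begin

definition V :: "'a \<Rightarrow> real" where "V x = \<rho> x powr \<alpha> * exp (u x)"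

lemma V_nonneg: "V x \<ge> 0" by (simp add: V_def)

lemma G_measurable: "i \<in> Basis \<Longrightarrow> (\<lambda>x. G x \<bullet> i) \<in> borel_measurable borel"
  using sol by (simp add: weak_sol_grad_def H1_loc_grad_def L2_loc_def)

lemma u_integrable: "compact K \<Longrightarrow> set_integrable lborel K u"
  using sol L2_loc_imp_set_integrable by (auto simp: weak_sol_grad_def H1_loc_grad_def)

lemma G_integrable: "compact K \<Longrightarrow> i \<in> Basis \<Longrightarrow> set_integrable lborel K (\<lambda>x. G x \<bullet> i)"
  using sol L2_loc_imp_set_integrable by (auto simp: weak_sol_grad_def H1_loc_grad_def)

lemma V_integrable: "compact K \<Longrightarrow> set_integrable lborel K V"
  using sol by (auto simp: weak_sol_grad_def L1_loc_def V_def[abs_def])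

lemma continuous_radial: "continuous_on UNIV g \<Longrightarrow> continuous_on UNIV (\<lambda>x. g (q x))"
  by (rule continuous_on_compose2[OF _ continuous_q]) auto

lemma tsupport_sublevel:
  assumes "\<And>x. q x > c \<Longrightarrow> \<phi> x = 0"
  shows "tsupport \<phi> \<subseteq> {x. q x \<le> c}"
  unfolding tsupport_def
  by (rule closure_minimal) (use assms compact_sublevel[of c] compact_imp_closed in force)+

lemma test_fun_sublevel:
  assumes "smooth \<phi>" "\<And>x. q x > c \<Longrightarrow> \<phi> x = 0"
  shows "test_fun_on UNIV \<phi>"
proof -
  have "compact ({x. q x \<le> c} \<inter> tsupport \<phi>)"
    by (intro compact_Int_closed compact_sublevel) (simp add: tsupport_def)
  then show ?thesis
    using tsupport_sublevel[OF assms(2)] assms(1) by (simp add: test_fun_on_def Int_absorb1)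
qed

text \<open>The gradient of a radial test function is a multiple of \<open>L x\<close>, so
  \<open>duality\<close> replaces the nonlinear flux by a multiple of
  \<open>G x \<bullet> x\<close>. The equation is then linear in \<open>G\<close>, and the weak
  derivative can be moved onto a multiple of the field \<open>x\<close>, whose divergence is the
  expression multiplying \<open>u\<close>.\<close>

lemma radial_equation:
  fixes g g' g'' :: "real \<Rightarrow> real"
  assumes sm: "smooth g" "smooth g'" "smooth g''"
    and g': "\<And>t. (g has_real_derivative g' t) (at t)"
    and g'': "\<And>t. (g' has_real_derivative g'' t) (at t)"
    and supp: "\<And>t. t > c \<Longrightarrow> g t = 0"
  shows "(\<integral>x. u x * (4 * q x * g'' (q x) + 2 * real DIM('a) * g' (q x)) \<partial>lborel)
       = - (\<integral>x. V x * g (q x) \<partial>lborel)"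
proof -
  have supp': "g' t = 0" if "t > c" for t
    using deriv_zero_above[of c g g' t] supp g' that by blast
  have supp'': "g'' t = 0" if "t > c" for t
    using deriv_zero_above[of c g' g'' t] supp' g'' that by blast
  \<comment> \<open>Components of the field paired with the weak gradient; the factor is
    \<open>x\<close> and not \<open>L x\<close> because \<open>duality\<close> has already removed
    \<open>L\<close>.\<close>
  define \<psi> where "\<psi> i x = 2 * g' (q x) * (x \<bullet> i)" for i x :: 'a
  have sm\<psi>: "smooth (\<psi> i)" for i
    unfolding \<psi>_def[abs_def]
    by (intro smooth_mult smooth_const smooth_compose[OF sm(2) smooth_q] smooth_linear
        bounded_linear_inner_left)
  have supp\<psi>: "\<psi> i x = 0" if "q x > c" for i x
    using supp' that by (simp add: \<psi>_def)
  have d\<psi>: "pderiv (\<psi> i) i x = 2 * g' (q x) + 4 * g'' (q x) * ((L x \<bullet> i) * (x \<bullet> i))"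
    if "i \<in> Basis" for i x
  proof -
    have "(\<psi> i has_derivative (\<lambda>h. 2 * g' (q x) * (h \<bullet> i) + 2 * (2 * g'' (q x) * (L x \<bullet> h)) * (x \<bullet> i))) (at x)"
      unfolding \<psi>_def[abs_def]
      by (intro has_derivative_mult has_derivative_mult_right radial_has_derivative g''
          bounded_linear_imp_has_derivative[OF bounded_linear_inner_left])
    from pderiv_eqI[OF this, of i] that show ?thesis by simp
  qed
  have H1: "(\<integral>x. u x * pderiv (\<psi> i) i x \<partial>lborel) = - (\<integral>x. (G x \<bullet> i) * \<psi> i x \<partial>lborel)"
    if "i \<in> Basis" for i
    using sol that test_fun_sublevel[OF sm\<psi> supp\<psi>]
    unfolding weak_sol_grad_def H1_loc_grad_def by blast
  have int1: "integrable lborel (\<lambda>x. u x * pderiv (\<psi> i) i x)" if "i \<in> Basis" for i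
  proof (rule integrable_mult_compact_support[OF u_integrable[OF compact_sublevel] compact_sublevel[of c]])
    show "continuous_on UNIV (pderiv (\<psi> i) i)"
      using that by (intro smooth_continuous_on smooth_pderiv sm\<psi>)
    show "pderiv (\<psi> i) i x = 0" if "x \<notin> {x. q x \<le> c}" for x
      using supp' supp'' that \<open>i \<in> Basis\<close> by (simp add: d\<psi>)
  qed
  have int2: "integrable lborel (\<lambda>x. (G x \<bullet> i) * \<psi> i x)" if "i \<in> Basis" for i
    by (rule integrable_mult_compact_support[OF G_integrable[OF compact_sublevel that] compact_sublevel[of c]])
      (use supp\<psi> in \<open>auto intro!: smooth_continuous_on sm\<psi>\<close>)
  have "test_fun_on UNIV (\<lambda>x. g (q x))"
    by (rule test_fun_sublevel[OF smooth_compose[OF sm(1) smooth_q]]) (rule supp)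
  then have eq: "(\<integral>x. F (G x) * (Fgrad F (G x) \<bullet> Fgrad (\<lambda>x. g (q x)) x) \<partial>lborel)
      = (\<integral>x. V x * g (q x) \<partial>lborel)"
    using sol unfolding weak_sol_grad_def V_def by blast
  have "F (G x) * (Fgrad F (G x) \<bullet> Fgrad (\<lambda>x. g (q x)) x) = (\<Sum>i\<in>Basis. (G x \<bullet> i) * \<psi> i x)" for x
  proof -
    have "Fgrad (\<lambda>x. g (q x)) x = (2 * g' (q x)) *\<^sub>R L x"
      by (rule Fgrad_eqI) (use radial_has_derivative[OF g'] in simp)
    then have "F (G x) * (Fgrad F (G x) \<bullet> Fgrad (\<lambda>x. g (q x)) x)
        = 2 * g' (q x) * (F (G x) * (Fgrad F (G x) \<bullet> L x))"
      by simp
    also have "\<dots> = 2 * g' (q x) * (\<Sum>i\<in>Basis. (G x \<bullet> i) * (x \<bullet> i))"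
      by (simp only: duality euclidean_inner[of "G x" x])
    also have "\<dots> = (\<Sum>i\<in>Basis. (G x \<bullet> i) * \<psi> i x)"
      unfolding sum_distrib_left \<psi>_def by (intro sum.cong refl) (simp add: mult_ac)
    finally show ?thesis .
  qed
  with eq have "(\<integral>x. V x * g (q x) \<partial>lborel) = (\<Sum>i\<in>Basis. \<integral>x. (G x \<bullet> i) * \<psi> i x \<partial>lborel)"
    using int2 by (simp add: Bochner_Integration.integral_sum)
  also have "\<dots> = - (\<Sum>i\<in>Basis. \<integral>x. u x * pderiv (\<psi> i) i x \<partial>lborel)"
    by (simp add: H1 sum_negf)
  also have "(\<Sum>i\<in>Basis. \<integral>x. u x * pderiv (\<psi> i) i x \<partial>lborel)
      = (\<integral>x. (\<Sum>i\<in>Basis. u x * pderiv (\<psi> i) i x) \<partial>lborel)"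
    using int1 by (simp add: Bochner_Integration.integral_sum)
  also have "(\<lambda>x. \<Sum>i\<in>Basis. u x * pderiv (\<psi> i) i x)
      = (\<lambda>x. u x * (4 * q x * g'' (q x) + 2 * real DIM('a) * g' (q x)))"
  proof
    fix x
    have "(\<Sum>i\<in>Basis. u x * pderiv (\<psi> i) i x)
        = u x * (\<Sum>i\<in>Basis. 2 * g' (q x) + 4 * g'' (q x) * ((L x \<bullet> i) * (x \<bullet> i)))"
      by (simp add: sum_distrib_left d\<psi>)
    also have "(\<Sum>i\<in>Basis. 2 * g' (q x) + 4 * g'' (q x) * ((L x \<bullet> i) * (x \<bullet> i)))
        = real DIM('a) * (2 * g' (q x)) + 4 * g'' (q x) * (L x \<bullet> x)"
      unfolding sum.distrib sum_distrib_left[symmetric] euclidean_inner[of "L x" x, symmetric] by simp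
    finally show "(\<Sum>i\<in>Basis. u x * pderiv (\<psi> i) i x)
        = u x * (4 * q x * g'' (q x) + 2 * real DIM('a) * g' (q x))"
      by (simp add: L_self algebra_simps)
  qed
  finally show ?thesis by simp
qed

text \<open>By \<open>hessian_identity\<close> the second variation at a radial function no longer
  sees \<open>G\<close> wherever \<open>G\<close> is nonzero, and it becomes the Dirichlet form
  \<open>4 * q x * (p' (q x))\<^sup>2\<close>. Where \<open>G\<close> is 0 it vanishes, which only
  helps the upper bound.\<close>

lemma radial_stability:
  fixes p p' :: "real \<Rightarrow> real"
  assumes sm: "smooth p" "smooth p'"
    and p': "\<And>t. (p has_real_derivative p' t) (at t)"
    and supp: "\<And>t. t > c \<Longrightarrow> p t = 0" "\<And>t. t < \<tau> \<Longrightarrow> p t = 0"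
    and S: "\<And>x. x \<in> S \<Longrightarrow> q x < \<tau>"
  shows "integrable lborel (\<lambda>x. V x * (p (q x))\<^sup>2)"
    and "integrable lborel (\<lambda>x. 4 * q x * (p' (q x))\<^sup>2)"
    and "(\<integral>x. V x * (p (q x))\<^sup>2 \<partial>lborel) \<le> (\<integral>x. 4 * q x * (p' (q x))\<^sup>2 \<partial>lborel)"
proof -
  have supp': "p' t = 0" if "t > c" for t
    using deriv_zero_above[of c p p' t] supp p' that by blast
  let ?\<phi> = "\<lambda>x. p (q x)"
  let ?K = "{x. q x \<le> c}"
  have cont: "continuous_on UNIV (\<lambda>x. p (q x))" "continuous_on UNIV (\<lambda>x. p' (q x))"
    by (intro continuous_radial smooth_continuous_on sm)+
  show int1: "integrable lborel (\<lambda>x. V x * (p (q x))\<^sup>2)"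
    by (rule integrable_mult_compact_support[OF V_integrable[OF compact_sublevel] compact_sublevel[of c]])
      (use supp in \<open>auto intro!: continuous_intros cont\<close>)
  have cont2: "continuous_on UNIV (\<lambda>x. 4 * q x * (p' (q x))\<^sup>2)"
    by (intro continuous_intros cont continuous_q)
  have one: "set_integrable lborel ?K (\<lambda>x. 1::real)"
    using compact_sublevel[of c] by (rule set_integrable_one_compact)
  show int2: "integrable lborel (\<lambda>x. 4 * q x * (p' (q x))\<^sup>2)"
    using integrable_mult_compact_support[OF one compact_sublevel cont2] supp' by auto
  \<comment> \<open>\<open>S\<close> lies where \<open>q\<close> is below \<open>\<tau>\<close>, so
    this closed set keeps the support off \<open>S\<close>.\<close>
  have "tsupport ?\<phi> \<subseteq> {x. \<tau> \<le> q x}"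
    unfolding tsupport_def
  proof (rule closure_minimal)
    show "{x. p (q x) \<noteq> 0} \<subseteq> {x. \<tau> \<le> q x}" using supp(2) by (auto simp: not_less[symmetric])
    show "closed {x. \<tau> \<le> q x}" by (intro closed_Collect_le continuous_intros continuous_q)
  qed
  moreover have "test_fun_on UNIV ?\<phi>"
    by (rule test_fun_sublevel[OF smooth_compose[OF sm(1) smooth_q]]) (rule supp)
  ultimately have "test_fun_on (- S) ?\<phi>"
    using S by (fastforce simp: test_fun_on_def)
  note st = stable[OF this]
  have pd: "pderiv ?\<phi> i x = 2 * p' (q x) * (L x \<bullet> i)" for i x
    by (rule pderiv_eqI[OF radial_has_derivative[OF p']])
  \<comment> \<open>Where \<open>G\<close> vanishes nothing is known about \<open>hess F 0\<close>,
    but it is multiplied by \<open>F 0 = 0\<close>, and \<open>Fgrad F 0\<close> is 0 as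
    well.\<close>
  define Q where "Q x = (if G x = 0 then 0 else 4 * q x * (p' (q x))\<^sup>2)" for x
  have Qeq: "(\<Sum>i\<in>Basis. \<Sum>j\<in>Basis.
               (Fgrad F (G x) \<bullet> i) * (Fgrad F (G x) \<bullet> j) * pderiv ?\<phi> i x * pderiv ?\<phi> j x
             + F (G x) * hess F (G x) i j * pderiv ?\<phi> i x * pderiv ?\<phi> j x) = Q x" for x
  proof (cases "G x = 0")
    case True
    have "Fgrad F 0 = 0" by (rule Fgrad_zero_at_min) (simp add: F_zero F_nonneg)
    then show ?thesis using True by (simp add: Q_def F_zero)
  next
    case False
    have "(\<Sum>i\<in>Basis. \<Sum>j\<in>Basis.
               (Fgrad F (G x) \<bullet> i) * (Fgrad F (G x) \<bullet> j) * pderiv ?\<phi> i x * pderiv ?\<phi> j x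
             + F (G x) * hess F (G x) i j * pderiv ?\<phi> i x * pderiv ?\<phi> j x)
       = (2 * p' (q x))\<^sup>2 * (\<Sum>i\<in>Basis. \<Sum>j\<in>Basis.
           (Fgrad F (G x) \<bullet> i) * (Fgrad F (G x) \<bullet> j) * (L x \<bullet> i) * (L x \<bullet> j)
           + F (G x) * hess F (G x) i j * (L x \<bullet> i) * (L x \<bullet> j))"
      unfolding pd sum_distrib_left by (intro sum.cong refl) (simp add: power2_eq_square algebra_simps)
    then show ?thesis
      using hessian_identity[OF False, of x] False by (simp add: Q_def power_mult_distrib mult_ac)
  qed
  \<comment> \<open>Measurability of \<open>G\<close> is given by components, hence the intersection
    over \<open>Basis\<close>.\<close>
  have "{x. G x = 0} = (\<Inter>i\<in>Basis. {x. G x \<bullet> i = 0})"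
    by (auto simp: euclidean_all_zero_iff)
  moreover have "{x. G x \<bullet> i = 0} \<in> sets borel" if "i \<in> Basis" for i
    using G_measurable[OF that] by measurable
  ultimately have [measurable]: "{x. G x = 0} \<in> sets borel"
    using sets.finite_INT[of Basis "\<lambda>i. {x. G x \<bullet> i = 0}" borel] by (simp add: nonempty_Basis)
  have intQ: "integrable lborel Q"
  proof (rule Bochner_Integration.integrable_bound[OF int2])
    have "Q = (\<lambda>x. indicator (- {x. G x = 0}) x * (4 * q x * (p' (q x))\<^sup>2))"
      by (auto simp: Q_def)
    then show "Q \<in> borel_measurable lborel"
      using borel_measurable_integrable[OF int2] by simp
    show "AE x in lborel. norm (Q x) \<le> norm (4 * q x * (p' (q x))\<^sup>2)"
      by (auto simp: Q_def)
  qed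
  have "0 \<le> (\<integral>x. Q x - V x * (p (q x))\<^sup>2 \<partial>lborel)"
    using st unfolding Qeq V_def .
  also have "\<dots> = (\<integral>x. Q x \<partial>lborel) - (\<integral>x. V x * (p (q x))\<^sup>2 \<partial>lborel)"
    by (rule Bochner_Integration.integral_diff[OF intQ int1])
  finally have "(\<integral>x. V x * (p (q x))\<^sup>2 \<partial>lborel) \<le> (\<integral>x. Q x \<partial>lborel)" by simp
  also have "\<dots> \<le> (\<integral>x. 4 * q x * (p' (q x))\<^sup>2 \<partial>lborel)"
    by (rule integral_mono[OF intQ int2]) (simp add: Q_def q_nonneg)
  finally show "(\<integral>x. V x * (p (q x))\<^sup>2 \<partial>lborel) \<le> (\<integral>x. 4 * q x * (p' (q x))\<^sup>2 \<partial>lborel)" .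
qed

end

section \<open>Two-sided cut-offs and the Hardy weight\<close>

locale cutoff =
  fixes \<theta> \<theta>' :: "real \<Rightarrow> real" and K :: real
  assumes smooth_\<theta>: "smooth \<theta>" and smooth_\<theta>': "smooth \<theta>'"
    and \<theta>_deriv: "\<And>t. (\<theta> has_real_derivative \<theta>' t) (at t)"
    and \<theta>'_nonneg: "\<And>t. \<theta>' t \<ge> 0"
    and \<theta>_zero: "\<And>t. t \<le> 1 \<Longrightarrow> \<theta> t = 0" and \<theta>_one: "\<And>t. t \<ge> 2 \<Longrightarrow> \<theta> t = 1"
    and \<theta>'_zero: "\<And>t. t \<le> 1 \<Longrightarrow> \<theta>' t = 0" "\<And>t. t \<ge> 2 \<Longrightarrow> \<theta>' t = 0"
    and K: "\<And>t. \<bar>t * \<theta>' t\<bar> \<le> K"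
begin

lemma \<theta>_mono: "s \<le> t \<Longrightarrow> \<theta> s \<le> \<theta> t"
  by (rule DERIV_nonneg_imp_nondecreasing[of s t \<theta>]) (use \<theta>_deriv \<theta>'_nonneg in blast)+

lemma \<theta>_bounds: "0 \<le> \<theta> t" "\<theta> t \<le> 1"
  using \<theta>_mono[of "min t 1" t] \<theta>_mono[of t "max t 2"] \<theta>_zero[of "min t 1"] \<theta>_one[of "max t 2"] by auto

lemma K_nonneg: "K \<ge> 0" using K[of 0] by simp

lemma \<theta>'_le: "\<theta>' t \<le> K"
proof (cases "t \<le> 1")
  case False
  then have "\<theta>' t \<le> t * \<theta>' t" using mult_right_mono[of 1 t "\<theta>' t"] \<theta>'_nonneg[of t] by simp
  then show ?thesis using K[of t] by linarith
qed (simp add: \<theta>'_zero K_nonneg)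

lemma smooth_scaled: "smooth (\<lambda>t. \<theta> (t / c))" "smooth (\<lambda>t. \<theta>' (t / c))"
proof -
  have "smooth (\<lambda>t::real. t / c)"
    using smooth_mult[OF smooth_ident smooth_const[of "1 / c"]] by simp
  then show "smooth (\<lambda>t. \<theta> (t / c))" "smooth (\<lambda>t. \<theta>' (t / c))"
    using smooth_compose smooth_\<theta> smooth_\<theta>' by blast+
qed

lemma scaled_deriv: "((\<lambda>t. \<theta> (t / c)) has_real_derivative \<theta>' (t / c) / c) (at t)"
proof (cases "c = 0")
  case False
  have "((\<lambda>t. t / c) has_real_derivative 1 / c) (at t)"
    by (rule DERIV_cdivide[OF DERIV_ident])
  from DERIV_chain2[where f = \<theta> and g = "\<lambda>t. t / c", OF \<theta>_deriv this] show ?thesis by simp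
qed simp

text \<open>For \<open>2 * \<tau> \<le> T\<close> this rises from 0 to 1 between
  \<open>\<tau>\<close> and \<open>2 * \<tau>\<close> and falls back between \<open>T\<close> and
  \<open>2 * T\<close>.\<close>

definition \<eta> :: "real \<Rightarrow> real \<Rightarrow> real \<Rightarrow> real" where
  "\<eta> \<tau> T t = \<theta> (t / \<tau>) * (1 - \<theta> (t / T))"

definition \<eta>' :: "real \<Rightarrow> real \<Rightarrow> real \<Rightarrow> real" where
  "\<eta>' \<tau> T t = \<theta>' (t / \<tau>) / \<tau> * (1 - \<theta> (t / T)) - \<theta> (t / \<tau>) * (\<theta>' (t / T) / T)"

lemma \<eta>_deriv: "(\<eta> \<tau> T has_real_derivative \<eta>' \<tau> T t) (at t)"
  unfolding \<eta>_def[abs_def] \<eta>'_def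
  by (rule derivative_eq_intros scaled_deriv refl)+ simp

lemma smooth_\<eta>: "smooth (\<eta> \<tau> T)"
  unfolding \<eta>_def[abs_def] by (intro smooth_mult smooth_diff smooth_const smooth_scaled)

text \<open>The bracket under the square is the derivative of
  \<open>t powr (- k / 4) * \<eta> \<tau> T t\<close> stripped of its power. On the plateau it is
  the constant \<open>- k / 4\<close>, which yields the Hardy constant \<open>k\<^sup>2 / 4\<close>;
  on the two transition zones a bound uniform in \<open>T\<close> is enough.\<close>

lemma hardy_weight_bound:
  assumes "\<tau> > 0" "\<tau> \<le> T" "k \<ge> 0" "t > 0"
  shows "4 * (t * \<eta>' \<tau> T t - k / 4 * \<eta> \<tau> T t)\<^sup>2 \<le> k\<^sup>2 / 4 * indicator {2 * \<tau>..T} t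
    + 4 * (k / 4 + 2 * K)\<^sup>2 * indicator {\<tau>..2 * \<tau>} t + 4 * (k / 4 + 2 * K)\<^sup>2 * indicator {T..2 * T} t"
proof -
  have T: "T > 0" using assms by linarith
  consider "t < \<tau>" | "t > 2 * T" | "2 * \<tau> \<le> t" "t \<le> T" | "t \<in> {\<tau>..2 * \<tau>} \<union> {T..2 * T}"
    using assms by fastforce
  then show ?thesis
  proof cases
    case 1
    then have "\<eta> \<tau> T t = 0" "\<eta>' \<tau> T t = 0"
      using assms by (simp_all add: \<eta>_def \<eta>'_def \<theta>_zero \<theta>'_zero)
    then show ?thesis by simp
  next
    case 2
    then have "\<theta> (t / T) = 1" "\<theta>' (t / T) = 0"
      using T by (auto intro!: \<theta>_one \<theta>'_zero simp: field_simps)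
    then have "\<eta> \<tau> T t = 0" "\<eta>' \<tau> T t = 0"
      by (simp_all add: \<eta>_def \<eta>'_def)
    then show ?thesis by simp
  next
    case 3
    then have "t / T \<le> 1" "t / \<tau> \<ge> 2"
      using T assms by (auto simp: field_simps)
    then have "\<theta> (t / T) = 0" "\<theta>' (t / T) = 0" "\<theta> (t / \<tau>) = 1" "\<theta>' (t / \<tau>) = 0"
      by (auto simp: \<theta>_one \<theta>'_zero \<theta>_zero)
    then have "\<eta> \<tau> T t = 1" "\<eta>' \<tau> T t = 0"
      by (simp_all add: \<eta>_def \<eta>'_def)
    then have "4 * (t * \<eta>' \<tau> T t - k / 4 * \<eta> \<tau> T t)\<^sup>2 = k\<^sup>2 / 4 * indicator {2 * \<tau>..T} t"
      using 3 by (simp add: power2_eq_square)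
    moreover have "0 \<le> 4 * (k / 4 + 2 * K)\<^sup>2 * indicator {\<tau>..2 * \<tau>} t"
      "0 \<le> 4 * (k / 4 + 2 * K)\<^sup>2 * indicator {T..2 * T} t"
      by simp_all
    ultimately show ?thesis by linarith
  next
    case 4
    have \<eta>: "0 \<le> \<eta> \<tau> T t" "\<eta> \<tau> T t \<le> 1"
      using \<theta>_bounds[of "t / \<tau>"] \<theta>_bounds[of "t / T"] mult_mono[of "\<theta> (t / \<tau>)" 1 "1 - \<theta> (t / T)" 1]
      by (auto simp: \<eta>_def)
    \<comment> \<open>Each factor of \<open>\<eta>\<close> contributes
      \<open>s * \<theta>' s\<close> with \<open>s = t / \<tau>\<close> or \<open>s = t / T\<close>,
      so the bound \<open>K\<close> does not depend on the scales.\<close>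
    have "\<bar>t * \<eta>' \<tau> T t\<bar> \<le> \<bar>t / \<tau> * \<theta>' (t / \<tau>)\<bar> * \<bar>1 - \<theta> (t / T)\<bar> + \<bar>\<theta> (t / \<tau>)\<bar> * \<bar>t / T * \<theta>' (t / T)\<bar>"
    proof -
      have "t * \<eta>' \<tau> T t = (t / \<tau> * \<theta>' (t / \<tau>)) * (1 - \<theta> (t / T)) - \<theta> (t / \<tau>) * (t / T * \<theta>' (t / T))"
        by (simp add: \<eta>'_def algebra_simps)
      then show ?thesis using abs_triangle_ineq4 by (metis abs_mult)
    qed
    also have "\<dots> \<le> K * 1 + 1 * K"
      using \<theta>_bounds[of "t / \<tau>"] \<theta>_bounds[of "t / T"] K_nonneg by (intro add_mono mult_mono K) auto
    finally have 1: "\<bar>t * \<eta>' \<tau> T t\<bar> \<le> 2 * K" by simp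
    have 2: "\<bar>k / 4 * \<eta> \<tau> T t\<bar> \<le> k / 4"
      using mult_left_mono[OF \<eta>(2), of "k / 4"] \<eta>(1) assms(3) by (simp add: abs_mult)
    have "\<bar>t * \<eta>' \<tau> T t - k / 4 * \<eta> \<tau> T t\<bar> \<le> k / 4 + 2 * K"
      using 1 2 by linarith
    then have "(t * \<eta>' \<tau> T t - k / 4 * \<eta> \<tau> T t)\<^sup>2 \<le> (k / 4 + 2 * K)\<^sup>2"
      using power_mono[of "\<bar>t * \<eta>' \<tau> T t - k / 4 * \<eta> \<tau> T t\<bar>" "k / 4 + 2 * K" 2] by simp
    moreover have "1 \<le> indicator {\<tau>..2 * \<tau>} t + (indicator {T..2 * T} t :: real)"
      using 4 by (auto simp: indicator_def)
    from mult_left_mono[OF this, of "4 * (k / 4 + 2 * K)\<^sup>2"]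
    have "4 * (k / 4 + 2 * K)\<^sup>2 \<le> 4 * (k / 4 + 2 * K)\<^sup>2 * indicator {\<tau>..2 * \<tau>} t
        + 4 * (k / 4 + 2 * K)\<^sup>2 * indicator {T..2 * T} t"
      by (simp add: distrib_left)
    moreover have "0 \<le> k\<^sup>2 / 4 * indicator {2 * \<tau>..T} t" by simp
    ultimately show ?thesis by linarith
  qed
qed

end

section \<open>Estimates at scale T and their incompatibility\<close>

locale stable_cutoff = stable_solution F a b \<alpha> u G S + cutoff \<theta> \<theta>' K
  for F :: "'a::euclidean_space \<Rightarrow> real" and a b \<alpha> u G S \<theta> \<theta>' K +
  fixes \<tau> k \<kappa> :: real
  assumes \<tau>: "\<tau> > 0" and S_sub: "\<And>x. x \<in> S \<Longrightarrow> q x < \<tau>"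
    and k: "k > 0" "real DIM('a) = k + 2"
    and \<kappa>: "\<kappa> > 0"
    and radial: "\<And>c d f f'. 0 < c \<Longrightarrow> c \<le> d \<Longrightarrow>
      (\<And>t. c \<le> t \<Longrightarrow> t \<le> d \<Longrightarrow> (f has_real_derivative f' t) (at t)) \<Longrightarrow>
      (\<And>t. c \<le> t \<Longrightarrow> t \<le> d \<Longrightarrow> isCont f' t) \<Longrightarrow>
      has_bochner_integral lborel (\<lambda>x. q x powr (- k / 2) * (f' (q x) * indicator {c..d} (q x)))
        (\<kappa> * (f d - f c))"
begin

text \<open>In the variable \<open>t = q x\<close> the exponent \<open>- k / 4\<close> is the Hardy
  extremal power \<open>- k / 2\<close> of \<open>\<rho>\<close>, cut off at both ends.\<close>

definition p :: "real \<Rightarrow> real \<Rightarrow> real" where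
  "p T t = t powr (- k / 4) * \<eta> \<tau> T t"

lemma p_square:
  assumes "2 * \<tau> \<le> t" "t \<le> T"
  shows "(p T t)\<^sup>2 = t powr (- k / 2)"
proof -
  have "\<theta> (t / T) = 0" "\<theta> (t / \<tau>) = 1"
    using assms \<tau> by (auto intro!: \<theta>_one \<theta>_zero simp: field_simps)
  then show ?thesis
    by (simp add: p_def \<eta>_def power2_eq_square flip: powr_add)
qed

text \<open>The borderline exponent: the antiderivative in \<open>radial\<close> is
  \<open>ln\<close>, so a shell counts only through the ratio of its end levels.\<close>

lemma log_integral:
  assumes "0 < c" "c \<le> d"
  shows "has_bochner_integral lborel (\<lambda>x. q x powr (- k / 2 - 1) * indicator {c..d} (q x)) (\<kappa> * ln (d / c))"
proof -
  have "q x powr (- k / 2 - 1) * indicator {c..d} (q x)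
      = q x powr (- k / 2) * (1 / q x * indicator {c..d} (q x))" for x
    using assms by (auto simp: indicator_def powr_diff)
  moreover have "has_bochner_integral lborel (\<lambda>x. q x powr (- k / 2) * (1 / q x * indicator {c..d} (q x)))
      (\<kappa> * (ln d - ln c))"
    using assms by (intro radial) (auto intro!: derivative_eq_intros continuous_intros)
  ultimately show ?thesis
    using assms by (simp add: ln_div)
qed

text \<open>Stability tested with \<open>p T\<close>. Only the plateau contributes a term growing
  with \<open>T\<close>; each transition zone spans a ratio of 2 and costs a fixed multiple of
  \<open>ln 2\<close>.\<close>

lemma stability_bound:
  assumes "2 * \<tau> \<le> T"
  shows "integrable lborel (\<lambda>x. V x * (p T (q x))\<^sup>2)"
    and "(\<integral>x. V x * (p T (q x))\<^sup>2 \<partial>lborel)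
      \<le> \<kappa> * (k\<^sup>2 / 4) * ln (T / (2 * \<tau>)) + 8 * (k / 4 + 2 * K)\<^sup>2 * (\<kappa> * ln 2)"
proof -
  have T: "T > 0" using assms \<tau> by linarith
  have below: "\<eta> \<tau> T t = 0" if "t < \<tau>" for t
    using that \<tau> by (simp add: \<eta>_def \<theta>_zero)
  have above: "\<eta> \<tau> T t = 0" if "t > 2 * T" for t
    using that T \<theta>_one[of "t / T"] by (simp add: \<eta>_def field_simps)
  have sm: "smooth (p T)"
    unfolding p_def[abs_def] using smooth_\<eta> \<tau> below by (rule smooth_powr_mult)
  define p' where "p' = pderiv (p T) 1"
  have p': "(p T has_real_derivative p' t) (at t)" "smooth p'" for t
    using smooth_real_deriv[OF sm] by (auto simp: p'_def)
  have p'_eq: "p' t = t powr (- k / 4 - 1) * (t * \<eta>' \<tau> T t - k / 4 * \<eta> \<tau> T t)" if "t > 0" for t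
  proof -
    have "(p T has_real_derivative (- k / 4 * t powr (- k / 4 - 1)) * \<eta> \<tau> T t
        + \<eta>' \<tau> T t * t powr (- k / 4)) (at t)"
      unfolding p_def[abs_def]
      by (intro DERIV_mult \<eta>_deriv has_real_derivative_powr that)
    moreover have "t powr (- k / 4) = t powr (- k / 4 - 1) * t"
      using that by (simp add: powr_diff)
    ultimately show ?thesis
      using DERIV_unique[OF p'(1)] by (simp add: algebra_simps)
  qed
  have p0: "p T t = 0" if "t < \<tau> \<or> t > 2 * T" for t
    using below above that by (auto simp: p_def)
  note st = radial_stability[of "p T" p' "2 * T" \<tau>, OF sm p'(2) p'(1) p0 p0 S_sub]
  show "integrable lborel (\<lambda>x. V x * (p T (q x))\<^sup>2)"
    using st(1) by simp
  define C where "C = 4 * (k / 4 + 2 * K)\<^sup>2"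
  let ?w = "\<lambda>x. q x powr (- k / 2 - 1)"
  let ?R = "\<lambda>x. k\<^sup>2 / 4 * (?w x * indicator {2 * \<tau>..T} (q x))
    + C * (?w x * indicator {\<tau>..2 * \<tau>} (q x)) + C * (?w x * indicator {T..2 * T} (q x))"
  have R: "has_bochner_integral lborel ?R (k\<^sup>2 / 4 * (\<kappa> * ln (T / (2 * \<tau>)))
      + C * (\<kappa> * ln (2 * \<tau> / \<tau>)) + C * (\<kappa> * ln (2 * T / T)))"
    using assms \<tau> T
    by (intro has_bochner_integral_add has_bochner_integral_mult_right log_integral) auto
  have pw: "4 * q x * (p' (q x))\<^sup>2 \<le> ?R x" for x
  proof (cases "q x > 0")
    case True
    \<comment> \<open>The factor \<open>q x\<close> raises the exponent \<open>- k / 2 - 2\<close>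
      of the squared derivative to that of \<open>log_integral\<close>.\<close>
    have "q x * (q x powr (- k / 4 - 1))\<^sup>2 = q x powr (1 + ((- k / 4 - 1) + (- k / 4 - 1)))"
      using True by (simp only: powr_add power2_eq_square) simp
    also have "\<dots> = ?w x" by (rule arg_cong[where f = "\<lambda>s. q x powr s"]) simp
    finally have "4 * q x * (p' (q x))\<^sup>2 = ?w x * (4 * (q x * \<eta>' \<tau> T (q x) - k / 4 * \<eta> \<tau> T (q x))\<^sup>2)"
      by (simp add: p'_eq[OF True] power_mult_distrib mult_ac)
    also have "\<dots> \<le> ?w x * (k\<^sup>2 / 4 * indicator {2 * \<tau>..T} (q x)
        + C * indicator {\<tau>..2 * \<tau>} (q x) + C * indicator {T..2 * T} (q x))"
      unfolding C_def using \<tau> assms k True by (intro mult_left_mono hardy_weight_bound) auto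
    finally show ?thesis by (simp add: algebra_simps)
  next
    case False
    then have "q x = 0" using q_nonneg[of x] by linarith
    then show ?thesis by simp
  qed
  have "(\<integral>x. V x * (p T (q x))\<^sup>2 \<partial>lborel) \<le> (\<integral>x. 4 * q x * (p' (q x))\<^sup>2 \<partial>lborel)"
    using st(3) by simp
  also have "\<dots> \<le> (\<integral>x. ?R x \<partial>lborel)"
    using st(2) by (intro integral_mono pw integrable.intros[OF R]) simp
  also have "\<dots> = k\<^sup>2 / 4 * (\<kappa> * ln (T / (2 * \<tau>))) + 2 * C * (\<kappa> * ln 2)"
    using has_bochner_integral_integral_eq[OF R] T \<tau> by simp
  finally show "(\<integral>x. V x * (p T (q x))\<^sup>2 \<partial>lborel)
      \<le> \<kappa> * (k\<^sup>2 / 4) * ln (T / (2 * \<tau>)) + 8 * (k / 4 + 2 * K)\<^sup>2 * (\<kappa> * ln 2)"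
    by (simp add: C_def mult_ac)
qed

text \<open>Averaging weight on the shell between \<open>q = T\<close> and \<open>q = 2 * T\<close>.
  The power compensates the volume growth, so its mass is \<open>\<kappa>\<close> for every positive
  \<open>T\<close>.\<close>

definition w :: "real \<Rightarrow> 'a \<Rightarrow> real" where
  "w T x = q x powr (- k / 2) * (\<theta>' (q x / T) / T)"

lemma w_nonneg: "T > 0 \<Longrightarrow> w T x \<ge> 0"
  by (simp add: w_def \<theta>'_nonneg)

lemma weighted_bump_continuous:
  assumes "T > 0"
  shows "continuous_on UNIV (\<lambda>x. q x powr s * (\<theta>' (q x / T) / T))"
proof -
  have "smooth (\<lambda>t. t powr s * (\<theta>' (t / T) * (1 / T)))"
  proof (rule smooth_powr_mult[OF _ assms])
    show "smooth (\<lambda>t. \<theta>' (t / T) * (1 / T))"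
      by (intro smooth_mult smooth_scaled smooth_const)
  qed (use assms in \<open>auto simp: \<theta>'_zero\<close>)
  from continuous_radial[OF smooth_continuous_on[OF this]] show ?thesis by simp
qed

lemma weighted_bump_zero:
  assumes "T > 0" "q x \<notin> {T..2 * T}"
  shows "\<theta>' (q x / T) = 0"
proof -
  have "q x / T \<le> 1 \<or> q x / T \<ge> 2"
    using assms by (auto simp: field_simps)
  then show ?thesis using \<theta>'_zero by blast
qed

lemma integrable_weighted_bump:
  assumes "T > 0" "\<And>K. compact K \<Longrightarrow> set_integrable lborel K f"
  shows "integrable lborel (\<lambda>x. f x * (q x powr s * (\<theta>' (q x / T) / T)))"
  by (rule integrable_mult_compact_support[OF assms(2)[OF compact_sublevel]
        compact_sublevel[of "2 * T"] weighted_bump_continuous[OF assms(1)]])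
    (use weighted_bump_zero[OF assms(1)] in auto)

lemma u_w_integrable: "T > 0 \<Longrightarrow> integrable lborel (\<lambda>x. u x * w T x)"
  unfolding w_def by (intro integrable_weighted_bump u_integrable)

text \<open>In the level variable the bump is the derivative of \<open>\<theta> (t / T)\<close>,
  which rises by exactly 1 across the shell.\<close>

lemma w_integral:
  assumes "T > 0"
  shows "has_bochner_integral lborel (w T) \<kappa>"
proof -
  have "isCont (\<lambda>t. \<theta>' (t / T) / T) t" for t
    using smooth_real_deriv(1)[OF smooth_scaled(2)[of T], THEN DERIV_isCont, of t] assms
    by (intro continuous_intros) auto
  then have "has_bochner_integral lborel
      (\<lambda>x. q x powr (- k / 2) * (\<theta>' (q x / T) / T * indicator {T..2 * T} (q x)))
      (\<kappa> * (\<theta> (2 * T / T) - \<theta> (T / T)))"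
    using assms by (intro radial scaled_deriv) auto
  moreover have "q x powr (- k / 2) * (\<theta>' (q x / T) / T * indicator {T..2 * T} (q x)) = w T x" for x
    using weighted_bump_zero[OF assms, of x] by (auto simp: w_def indicator_def)
  ultimately show ?thesis
    using assms by (simp add: \<theta>_one \<theta>_zero)
qed

text \<open>The radial profile \<open>g\<close> below solves \<open>-\<Delta> g = 2 (w \<tau> - w T)\<close>, where \<open>\<Delta>\<close> is the Laplacian of the
  inner product behind \<open>F\<close>; it is dominated by the fundamental solution, which is
  \<open>(p (2 * T))\<^sup>2 / k\<close> on \<open>2 \<tau> \<le> q \<le> 2 T\<close>.\<close>

lemma mean_decay:
  assumes T: "2 * \<tau> \<le> T"
  shows "2 * (\<integral>x. u x * w \<tau> x \<partial>lborel) - 2 * (\<integral>x. u x * w T x \<partial>lborel)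
    \<le> \<tau> powr (- k / 2) / k * (\<integral>x. V x * indicator {x. q x \<le> 2 * \<tau>} x \<partial>lborel)
      + (\<integral>x. V x * (p (2 * T) (q x))\<^sup>2 \<partial>lborel) / k"
proof -
  have Tpos: "T > 0" using T \<tau> by linarith
  \<comment> \<open>\<open>P\<close> is nonzero only between \<open>\<tau>\<close> and
    \<open>2 * T\<close>, stays in [0, 1], and its derivative produces the difference of the weights
    \<open>w \<tau>\<close> and \<open>w T\<close>.\<close>
  define P where "P t = \<theta> (t / \<tau>) - \<theta> (t / T)" for t
  define P' where "P' t = \<theta>' (t / \<tau>) / \<tau> - \<theta>' (t / T) / T" for t
  have P': "(P has_real_derivative P' t) (at t)" for t
    unfolding P_def[abs_def] P'_def by (intro DERIV_diff scaled_deriv)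
  have P_below: "P t = 0" if "t \<le> \<tau>" for t
  proof -
    have "t / \<tau> \<le> 1" "t / T \<le> 1" using that \<tau> T Tpos by (auto simp: field_simps)
    then show ?thesis by (simp add: P_def \<theta>_zero)
  qed
  have P_above: "P t = 0" if "t \<ge> 2 * T" for t
  proof -
    have "t / \<tau> \<ge> 2" "t / T \<ge> 2" using that \<tau> T Tpos by (auto simp: field_simps)
    then show ?thesis by (simp add: P_def \<theta>_one)
  qed
  have P_nonneg: "P t \<ge> 0" for t
  proof (cases "t \<le> \<tau>")
    case False
    then have "t / T \<le> t / \<tau>" using \<tau> T by (intro divide_left_mono) auto
    then show ?thesis using \<theta>_mono by (simp add: P_def)
  qed (simp add: P_below)
  have P_le: "P t \<le> 1" for t
    using \<theta>_bounds[of "t / \<tau>"] \<theta>_bounds[of "t / T"] by (simp add: P_def)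
  \<comment> \<open>\<open>h\<close> is the derivative of the profile. The operator
    \<open>4 * t * h' + 2 * (k + 2) * h\<close> is \<open>4 * t powr (- k / 2)\<close> times the
    derivative of \<open>t powr (k / 2 + 1) * h\<close>, so the equation is solved by making that
    product \<open>- P / 2\<close>.\<close>
  define h where "h t = t powr (- k / 2 - 1) * (- 1 / 2 * P t)" for t
  have smP: "smooth (\<lambda>t. - 1 / 2 * P t)"
    unfolding P_def by (intro smooth_mult smooth_const smooth_diff smooth_scaled)
  have smh: "smooth h"
    unfolding h_def[abs_def] by (rule smooth_powr_mult[OF smP \<tau>]) (simp add: P_below)
  define h' where "h' = pderiv h 1"
  have h': "(h has_real_derivative h' t) (at t)" "smooth h'" for t
    using smooth_real_deriv[OF smh] by (auto simp: h'_def)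
  have h'_eq: "4 * t * h' t + 2 * (k + 2) * h t = - 2 * (t powr (- k / 2) * P' t)" if "t > 0" for t
  proof -
    have "(h has_real_derivative ((- k / 2 - 1) * t powr (- k / 2 - 1 - 1)) * (- 1 / 2 * P t)
        + (- 1 / 2 * P' t) * t powr (- k / 2 - 1)) (at t)"
      unfolding h_def[abs_def]
      by (intro DERIV_mult DERIV_cmult P' has_real_derivative_powr that)
    then have 1: "h' t = ((- k / 2 - 1) * t powr (- k / 2 - 1 - 1)) * (- 1 / 2 * P t)
        + (- 1 / 2 * P' t) * t powr (- k / 2 - 1)"
      using DERIV_unique[OF h'(1)] by blast
    have "t powr s = t * t powr (s - 1)" for s
      using that powr_mult_base[of t "s - 1"] by simp
    then have 2: "t powr (- k / 2) = t * t powr (- k / 2 - 1)"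
      "t powr (- k / 2 - 1) = t * t powr (- k / 2 - 1 - 1)"
      by blast+
    define z where "z = t powr (- k / 2 - 1 - 1)"
    show ?thesis
      unfolding h_def 1 2(1) unfolding 2(2) z_def[symmetric]
      by (simp add: field_simps)
  qed
  obtain H where H: "smooth H" "\<And>t. (H has_real_derivative h t) (at t)"
    using smooth_antiderivative[OF smh] by blast
  \<comment> \<open>Normalised to vanish at \<open>2 * T\<close>, hence also beyond, where
    \<open>h\<close> is 0; this gives the test function compact support.\<close>
  define g where "g t = H t - H (2 * T)" for t
  have smg: "smooth g" unfolding g_def[abs_def] by (intro smooth_diff smooth_const H)
  have g': "(g has_real_derivative h t) (at t)" for t
    unfolding g_def[abs_def] by (auto intro!: derivative_eq_intros H)
  have h_nonpos: "h t \<le> 0" for t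
    using P_nonneg[of t] by (simp add: h_def mult_nonneg_nonpos)
  have g_mono: "g t \<le> g s" if "s \<le> t" for s t
    by (rule DERIV_nonpos_imp_nonincreasing[OF that]) (use g' h_nonpos in blast)
  have g_top: "g (2 * T) = 0" by (simp add: g_def)
  have g_above: "g t = 0" if "t \<ge> 2 * T" for t
  proof (rule antisym)
    show "g t \<le> 0" using g_mono[OF that] g_top by simp
    have "g (2 * T) \<le> g t"
      by (rule DERIV_nonneg_imp_nondecreasing[OF that])
        (use g' P_above in \<open>force simp: h_def\<close>)
    then show "0 \<le> g t" using g_top by simp
  qed
  have g_le: "g t \<le> t powr (- k / 2) / k" if "t > 0" for t
  proof (cases "t \<le> 2 * T")
    case True
    \<comment> \<open>The comparison function has derivative
      \<open>- t powr (- k / 2 - 1) / 2\<close>, which is \<open>h\<close> with \<open>P\<close>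
      replaced by 1. As \<open>P \<le> 1\<close>, the difference is nonincreasing, and it is
      nonnegative at \<open>2 * T\<close>.\<close>
    have "(2 * T) powr (- k / 2) / k - g (2 * T) \<le> t powr (- k / 2) / k - g t"
    proof (rule DERIV_nonpos_imp_nonincreasing[OF True])
      fix s assume "t \<le> s" "s \<le> 2 * T"
      then have "s > 0" using that by linarith
      have "((\<lambda>t. t powr (- k / 2) / k - g t) has_real_derivative
          (- k / 2 * s powr (- k / 2 - 1)) / k - h s) (at s)"
        by (intro DERIV_diff DERIV_cdivide g' has_real_derivative_powr \<open>s > 0\<close>)
      moreover have "(- k / 2 * s powr (- k / 2 - 1)) / k - h s = s powr (- k / 2 - 1) * (P s - 1) / 2"
        using k by (simp add: h_def field_simps)
      moreover have "\<dots> \<le> 0"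
        using P_le[of s] by (simp add: mult_nonneg_nonpos)
      ultimately show "\<exists>y. ((\<lambda>t. t powr (- k / 2) / k - g t) has_real_derivative y) (at s) \<and> y \<le> 0"
        by auto
    qed
    moreover have "0 \<le> (2 * T) powr (- k / 2) / k" using k by simp
    ultimately show ?thesis using g_top by linarith
  next
    case False
    then show ?thesis using g_above[of t] k by simp
  qed
  \<comment> \<open>\<open>g\<close> is constant up to \<open>\<tau>\<close> and nonincreasing after
    it, so its value at \<open>\<tau>\<close> is the maximum.\<close>
  have g_bounded: "g t \<le> \<tau> powr (- k / 2) / k" for t
  proof (cases "t \<le> \<tau>")
    case True
    have "g t \<le> g \<tau>"
      by (rule DERIV_nonneg_imp_nondecreasing[OF True])
        (use g' P_below in \<open>force simp: h_def\<close>)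
    then show ?thesis using g_le[OF \<tau>] by linarith
  next
    case False
    then show ?thesis using g_mono[of \<tau> t] g_le[OF \<tau>] by linarith
  qed
  define M where "M = \<tau> powr (- k / 2) / k"
  have M: "M \<ge> 0" using k by (simp add: M_def)
  \<comment> \<open>The cut-off \<open>p\<close> is taken at scale \<open>2 * T\<close> so that
    \<open>p_square\<close> reaches the end of the support of \<open>g\<close>; the inner region
    costs a constant independent of \<open>T\<close>.\<close>
  have pw: "V x * g (q x) \<le> M * (V x * indicator {x. q x \<le> 2 * \<tau>} x) + V x * (p (2 * T) (q x))\<^sup>2 / k" for x
  proof -
    have "g (q x) \<le> M * indicator {x. q x \<le> 2 * \<tau>} x + (p (2 * T) (q x))\<^sup>2 / k"
    proof -
      consider "q x \<le> 2 * \<tau>" | "2 * \<tau> < q x" "q x \<le> 2 * T" | "q x > 2 * T" by linarith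
      then show ?thesis
      proof cases
        case 1
        then show ?thesis
          using g_bounded[of "q x"] k by (simp add: M_def add_increasing2)
      next
        case 2
        then show ?thesis
          using g_le[of "q x"] p_square[of "q x" "2 * T"] \<tau> by simp
      next
        case 3
        then show ?thesis
          using g_above[of "q x"] M k by simp
      qed
    qed
    from mult_left_mono[OF this V_nonneg[of x]] show ?thesis
      by (simp add: algebra_simps)
  qed
  have int1: "integrable lborel (\<lambda>x. V x * g (q x))"
    by (rule integrable_mult_compact_support[OF V_integrable[OF compact_sublevel] compact_sublevel[of "2 * T"]])
      (use g_above in \<open>auto intro!: smooth_continuous_on smooth_compose[OF smg smooth_q]\<close>)
  have int2: "integrable lborel (\<lambda>x. V x * indicator {x. q x \<le> 2 * \<tau>} x)"
    using V_integrable[OF compact_sublevel[of "2 * \<tau>"]] by (simp add: set_integrable_def mult.commute)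
  have int3: "integrable lborel (\<lambda>x. V x * (p (2 * T) (q x))\<^sup>2)"
    by (rule stability_bound) (use T \<tau> in linarith)
  have "(\<integral>x. u x * (4 * q x * h' (q x) + 2 * real DIM('a) * h (q x)) \<partial>lborel)
       = - (\<integral>x. V x * g (q x) \<partial>lborel)"
    by (rule radial_equation[OF smg smh h'(2) g' h'(1), of "2 * T"]) (simp add: g_above)
  moreover have "u x * (4 * q x * h' (q x) + 2 * real DIM('a) * h (q x))
      = 2 * (u x * w T x) - 2 * (u x * w \<tau> x)" for x
  proof (cases "q x > 0")
    case True
    then show ?thesis
      unfolding k(2) h'_eq[OF True] by (simp add: w_def P'_def algebra_simps)
  next
    case False
    then have "q x = 0" using q_nonneg[of x] by linarith
    then show ?thesis by (simp add: w_def h_def)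
  qed
  ultimately have "2 * (\<integral>x. u x * w T x \<partial>lborel) - 2 * (\<integral>x. u x * w \<tau> x \<partial>lborel)
      = - (\<integral>x. V x * g (q x) \<partial>lborel)"
    using u_w_integrable[OF Tpos] u_w_integrable[OF \<tau>] by simp
  moreover have "(\<integral>x. V x * g (q x) \<partial>lborel)
      \<le> (\<integral>x. M * (V x * indicator {x. q x \<le> 2 * \<tau>} x) + V x * (p (2 * T) (q x))\<^sup>2 / k \<partial>lborel)"
    using int1 int2 int3 pw by (intro integral_mono) auto
  moreover have "\<dots> = M * (\<integral>x. V x * indicator {x. q x \<le> 2 * \<tau>} x \<partial>lborel)
      + (\<integral>x. V x * (p (2 * T) (q x))\<^sup>2 \<partial>lborel) / k"
    using int2 int3 by simp
  ultimately show ?thesis by (simp add: M_def)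
qed

text \<open>Jensen's inequality for \<open>exp\<close> with the weight \<open>w T\<close>. On the
  shell \<open>exp (u x) * w T x\<close> is \<open>V x * (p (2 * T) (q x))\<^sup>2\<close> with a
  factor at most of order \<open>T powr (- \<alpha> / 2 - 1)\<close>, a form to which stability
  applies.\<close>

lemma jensen_bound:
  assumes T: "2 * \<tau> \<le> T"
  shows "\<kappa> * exp ((\<integral>x. u x * w T x \<partial>lborel) / \<kappa>)
    \<le> K * max 1 (2 powr (- \<alpha> / 2)) * T powr (- \<alpha> / 2 - 1) * (\<integral>x. V x * (p (2 * T) (q x))\<^sup>2 \<partial>lborel)"
proof -
  have Tpos: "T > 0" using T \<tau> by linarith
  define m where "m = (\<integral>x. u x * w T x \<partial>lborel) / \<kappa>"
  \<comment> \<open>\<open>exp (u x) * w T x\<close> written through \<open>V\<close>, whose local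
    integrability is part of being a solution.\<close>
  define E where "E x = V x * (q x powr (- k / 2 - \<alpha> / 2) * (\<theta>' (q x / T) / T))" for x
  have E_eq: "E x = exp (u x) * w T x" for x
  proof (cases "x = 0")
    case False
    then have q: "q x > 0" by (rule q_pos)
    have "\<rho> x powr \<alpha> = (q x powr (1 / 2)) powr \<alpha>"
      using q by (simp add: rho_eq_sqrt powr_half_sqrt)
    also have "\<dots> = q x powr (\<alpha> / 2)" by (simp add: powr_powr)
    finally have "\<rho> x powr \<alpha> * q x powr (- k / 2 - \<alpha> / 2) = q x powr (- k / 2)"
      by (simp flip: powr_add)
    then show ?thesis by (simp add: E_def V_def w_def mult_ac)
  qed (simp add: E_def w_def q_zero)
  have intE: "integrable lborel E"
    unfolding E_def by (rule integrable_weighted_bump[OF Tpos V_integrable])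
  have intw: "integrable lborel (w T)" and w: "(\<integral>x. w T x \<partial>lborel) = \<kappa>"
    using w_integral[OF Tpos] by (auto simp: has_bochner_integral_iff)
  have intu: "integrable lborel (\<lambda>x. u x * w T x)" by (rule u_w_integrable[OF Tpos])
  have "(\<integral>x. u x * w T x \<partial>lborel) = m * \<kappa>"
    using \<kappa> by (simp add: m_def)
  then have "\<kappa> * exp m = (\<integral>x. exp m * ((1 - m) * w T x + u x * w T x) \<partial>lborel)"
    using intw intu w by (simp add: left_diff_distrib)
  also have "\<dots> \<le> (\<integral>x. E x \<partial>lborel)"
  proof (rule integral_mono)
    show "exp m * ((1 - m) * w T x + u x * w T x) \<le> E x" for x
    proof -
      \<comment> \<open>The tangent of \<open>exp\<close> at the mean \<open>m\<close> lies below
        its graph; integration against \<open>w T\<close> removes the linear term.\<close>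
      have "exp m * (1 + (u x - m)) \<le> exp m * exp (u x - m)"
        by (intro mult_left_mono exp_ge_add_one_self) auto
      also have "\<dots> = exp (u x)" by (simp flip: exp_add)
      finally have "exp m * (1 + (u x - m)) * w T x \<le> exp (u x) * w T x"
        using w_nonneg[OF Tpos, of x] by (rule mult_right_mono)
      then show ?thesis by (simp add: E_eq algebra_simps)
    qed
  qed (use intw intu intE in auto)
  also have "\<dots> \<le> (\<integral>x. K * max 1 (2 powr (- \<alpha> / 2)) * T powr (- \<alpha> / 2 - 1) * (V x * (p (2 * T) (q x))\<^sup>2) \<partial>lborel)"
  proof (rule integral_mono[OF intE])
    show "integrable lborel (\<lambda>x. K * max 1 (2 powr (- \<alpha> / 2)) * T powr (- \<alpha> / 2 - 1)
        * (V x * (p (2 * T) (q x))\<^sup>2))"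
      by (intro integrable_mult_right stability_bound) (use T \<tau> in linarith)
    show "E x \<le> K * max 1 (2 powr (- \<alpha> / 2)) * T powr (- \<alpha> / 2 - 1) * (V x * (p (2 * T) (q x))\<^sup>2)" for x
    proof (cases "q x \<in> {T..2 * T}")
      case True
      then have q: "q x > 0" using Tpos by auto
      \<comment> \<open>The power is largest at the inner edge \<open>T\<close> for
        \<open>\<alpha> \<ge> 0\<close> and at the outer edge \<open>2 * T\<close> otherwise; the
        maximum covers both signs.\<close>
      have "q x powr (- \<alpha> / 2) \<le> max 1 (2 powr (- \<alpha> / 2)) * T powr (- \<alpha> / 2)"
      proof (cases "\<alpha> \<ge> 0")
        case \<alpha>: True
        have "q x powr (- \<alpha> / 2) \<le> 1 * T powr (- \<alpha> / 2)"
          using powr_mono2'[of "\<alpha> / 2 * -1" T "q x"] \<alpha> True Tpos by auto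
        also have "\<dots> \<le> max 1 (2 powr (- \<alpha> / 2)) * T powr (- \<alpha> / 2)"
          by (intro mult_right_mono) auto
        finally show ?thesis .
      next
        case \<alpha>: False
        have "q x powr (- \<alpha> / 2) \<le> (2 * T) powr (- \<alpha> / 2)"
          using \<alpha> True q by (intro powr_mono2) auto
        also have "\<dots> = 2 powr (- \<alpha> / 2) * T powr (- \<alpha> / 2)"
          using Tpos by (simp add: powr_mult)
        also have "\<dots> \<le> max 1 (2 powr (- \<alpha> / 2)) * T powr (- \<alpha> / 2)"
          by (intro mult_right_mono) auto
        finally show ?thesis .
      qed
      then have "q x powr (- \<alpha> / 2) * (\<theta>' (q x / T) / T)
          \<le> max 1 (2 powr (- \<alpha> / 2)) * T powr (- \<alpha> / 2) * (K / T)"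
        using \<theta>'_le[of "q x / T"] \<theta>'_nonneg[of "q x / T"] Tpos
        by (intro mult_mono divide_right_mono) auto
      also have "\<dots> = K * max 1 (2 powr (- \<alpha> / 2)) * T powr (- \<alpha> / 2 - 1)"
        using Tpos by (simp add: powr_diff)
      finally have "V x * (p (2 * T) (q x))\<^sup>2 * (q x powr (- \<alpha> / 2) * (\<theta>' (q x / T) / T))
          \<le> V x * (p (2 * T) (q x))\<^sup>2 * (K * max 1 (2 powr (- \<alpha> / 2)) * T powr (- \<alpha> / 2 - 1))"
        by (intro mult_left_mono) (simp_all add: V_nonneg)
      moreover have "(p (2 * T) (q x))\<^sup>2 = q x powr (- k / 2)"
        using True T by (intro p_square) auto
      moreover have "q x powr (- k / 2 - \<alpha> / 2) = q x powr (- k / 2) * q x powr (- \<alpha> / 2)"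
        by (simp flip: powr_add)
      ultimately show ?thesis by (simp add: E_def mult_ac)
    next
      case False
      then show ?thesis
        using weighted_bump_zero[OF Tpos False] K_nonneg V_nonneg[of x] by (simp add: E_def)
    qed
  qed
  finally show ?thesis by (simp add: m_def)
qed

text \<open>The lower bound on the mean of \<open>u\<close> loses \<open>T powr (- k / 8)\<close>,
  while stability gives \<open>T powr (- \<alpha> / 2 - 1)\<close> up to a logarithm. The assumption
  says that the surplus exponent \<open>\<delta>\<close> is positive, so a fixed positive number
  would be bounded by a quantity tending to 0.\<close>

lemma contradiction:
  assumes "k < 4 * (\<alpha> + 2)"
  shows False
proof -
  \<comment> \<open>The terms of \<open>stability_bound\<close> at scale \<open>2 * T\<close> that
    do not grow; the last one comes from
    \<open>ln (2 * T / (2 * \<tau>)) = ln T - ln \<tau>\<close>.\<close>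
  define c0 where "c0 = 8 * (k / 4 + 2 * K)\<^sup>2 * (\<kappa> * ln 2) - \<kappa> * (k\<^sup>2 / 4) * ln \<tau>"
  define I where "I T = (\<integral>x. V x * (p (2 * T) (q x))\<^sup>2 \<partial>lborel)" for T
  \<comment> \<open>The part independent of \<open>T\<close> in the lower bound for the integral of
    \<open>u x * w T x\<close>; the halves appear because \<open>mean_decay\<close> bounds twice the
    difference.\<close>
  define A where "A = (\<integral>x. u x * w \<tau> x \<partial>lborel)
    - \<tau> powr (- k / 2) / k * (\<integral>x. V x * indicator {x. q x \<le> 2 * \<tau>} x \<partial>lborel) / 2 - c0 / (2 * k)"
  define B where "B = K * max 1 (2 powr (- \<alpha> / 2))"
  define \<delta> where "\<delta> = \<alpha> / 2 + 1 - k / 8"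
  have \<delta>: "\<delta> > 0" using assms by (simp add: \<delta>_def)
  have B: "B \<ge> 0" using K_nonneg by (simp add: B_def)
  have main: "\<kappa> * exp (A / \<kappa>) \<le> B * (T powr (- \<delta>) * (\<kappa> * (k\<^sup>2 / 4) * ln T + c0))"
    if T: "2 * \<tau> \<le> T" for T
  proof -
    have Tpos: "T > 0" using T \<tau> by linarith
    have I: "I T \<le> \<kappa> * (k\<^sup>2 / 4) * ln T + c0"
      using stability_bound(2)[of "2 * T"] T \<tau> Tpos
      by (simp add: I_def c0_def ln_div algebra_simps diff_divide_distrib)
    define U where "U = (\<integral>x. u x * w T x \<partial>lborel)"
    have "I T / k \<le> (\<kappa> * (k\<^sup>2 / 4) * ln T + c0) / k"
      using I k by (intro divide_right_mono) auto
    also have "\<dots> = \<kappa> * k / 4 * ln T + c0 / k"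
      using k by (simp add: field_simps power2_eq_square)
    finally have "A - \<kappa> * k / 8 * ln T \<le> U"
      using mean_decay[OF T] by (simp add: A_def I_def U_def field_simps)
    then have "(A - \<kappa> * k / 8 * ln T) / \<kappa> \<le> U / \<kappa>"
      using \<kappa> by (intro divide_right_mono) auto
    moreover have "(A - \<kappa> * k / 8 * ln T) / \<kappa> = A / \<kappa> + (- k / 8) * ln T"
      using \<kappa> by (simp add: field_simps)
    ultimately have le: "exp (A / \<kappa> + (- k / 8) * ln T) \<le> exp (U / \<kappa>)" by simp
    have eq: "exp (A / \<kappa> + (- k / 8) * ln T) = exp (A / \<kappa>) * T powr (- k / 8)"
      unfolding exp_add powr_def using Tpos by simp
    have "\<kappa> * (exp (A / \<kappa>) * T powr (- k / 8)) \<le> \<kappa> * exp (U / \<kappa>)"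
      using le[unfolded eq] less_imp_le[OF \<kappa>] by (rule mult_left_mono)
    also have "\<dots> \<le> B * T powr (- \<alpha> / 2 - 1) * I T"
      using jensen_bound[OF T] by (simp add: U_def B_def I_def)
    also have "\<dots> \<le> B * T powr (- \<alpha> / 2 - 1) * (\<kappa> * (k\<^sup>2 / 4) * ln T + c0)"
      using I B by (intro mult_left_mono) auto
    finally have "\<kappa> * (exp (A / \<kappa>) * T powr (- k / 8)) * T powr (k / 8)
        \<le> B * T powr (- \<alpha> / 2 - 1) * (\<kappa> * (k\<^sup>2 / 4) * ln T + c0) * T powr (k / 8)"
      by (intro mult_right_mono) auto
    moreover have "\<kappa> * (exp (A / \<kappa>) * T powr (- k / 8)) * T powr (k / 8) = \<kappa> * exp (A / \<kappa>)"
      using Tpos by (simp add: mult.assoc flip: powr_add)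
    moreover have "T powr (- \<delta>) = T powr (- \<alpha> / 2 - 1) * T powr (k / 8)"
      unfolding powr_add[symmetric] \<delta>_def by (rule arg_cong[where f = "\<lambda>s. T powr s"]) simp
    ultimately show ?thesis by (simp only: mult_ac)
  qed
  have "((\<lambda>T. B * (T powr (- \<delta>) * (\<kappa> * (k\<^sup>2 / 4) * ln T + c0))) \<longlongrightarrow> B * 0) at_top"
    using \<delta> by (intro tendsto_mult tendsto_const) real_asymp
  moreover have "\<forall>\<^sub>F T in at_top. \<kappa> * exp (A / \<kappa>) \<le> B * (T powr (- \<delta>) * (\<kappa> * (k\<^sup>2 / 4) * ln T + c0))"
    using eventually_ge_at_top[of "2 * \<tau>"] by eventually_elim (rule main)
  ultimately have "\<kappa> * exp (A / \<kappa>) \<le> 0"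
    using tendsto_lowerbound[of _ "B * 0" at_top] by fastforce
  then show False using \<kappa> by (simp add: mult_le_0_iff)
qed

end

section \<open>Choice of the cut-off data and conclusion\<close>

theorem theorem1p6:
  fixes F :: "'a::euclidean_space \<Rightarrow> real" and \<alpha> a b \<mu> \<Lambda> :: real
  assumes alpha: "\<alpha> > -2"
    and dim: "3 \<le> DIM('a)" "real DIM('a) < 10 + 4 * min \<alpha> 0"
    and F_nonneg: "\<forall>\<xi>. F \<xi> \<ge> 0"
    and F_convex: "convex_on UNIV F"
    and F_C2: "C2_on (UNIV - {0}) F"
    and F_hom: "\<forall>t \<xi>. F (t *\<^sub>R \<xi>) = \<bar>t\<bar> * F \<xi>"
    and F_pos: "\<forall>\<xi>. \<xi> \<noteq> 0 \<longrightarrow> F \<xi> > 0"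
    and ab: "0 < a" "a \<le> b" "\<forall>\<xi>. a * norm \<xi> \<le> F \<xi> \<and> F \<xi> \<le> b * norm \<xi>"
    and ell: "\<mu> > 0" "\<Lambda> > 0"
      "\<forall>\<xi> V. norm \<xi> = 1 \<and> V \<bullet> \<xi> = 0 \<longrightarrow>
         \<mu>\<^sup>2 * (norm V)\<^sup>2 \<le> (\<Sum>i\<in>Basis. \<Sum>j\<in>Basis. hess F \<xi> i j * (V \<bullet> i) * (V \<bullet> j)) \<and>
         (\<Sum>i\<in>Basis. \<Sum>j\<in>Basis. hess F \<xi> i j * (V \<bullet> i) * (V \<bullet> j)) \<le> \<Lambda> * (norm V)\<^sup>2"
    and dual: "\<forall>x y. x \<noteq> 0 \<and> y \<noteq> 0 \<longrightarrow>
         Fgrad F x \<bullet> Fgrad (Fdual F) y = (x \<bullet> y) / (F x * Fdual F y)"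
  shows "\<not> (\<exists>u. weak_solution F \<alpha> u \<and> stable_outside_compact F \<alpha> u)"
proof
  assume "\<exists>u. weak_solution F \<alpha> u \<and> stable_outside_compact F \<alpha> u"
  \<comment> \<open>The stability predicate carries its own \<open>weak_sol_grad\<close>, so
    equation and stability refer to the same weak gradient \<open>G\<close>.\<close>
  then obtain u G S where sol: "weak_sol_grad F \<alpha> u G" "compact S"
    and stable: "\<And>\<phi>. test_fun_on (- S) \<phi> \<Longrightarrow>
        (\<integral>x. (\<Sum>i\<in>Basis. \<Sum>j\<in>Basis.
               (Fgrad F (G x) \<bullet> i) * (Fgrad F (G x) \<bullet> j) * pderiv \<phi> i x * pderiv \<phi> j x
             + F (G x) * hess F (G x) i j * pderiv \<phi> i x * pderiv \<phi> j x)
           - Fdual F x powr \<alpha> * exp (u x) * (\<phi> x)\<^sup>2 \<partial>lborel) \<ge> 0"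
    unfolding stable_outside_compact_def by blast
  interpret stable_solution F a b \<alpha> u G S
    by unfold_locales (use F_C2 F_hom ab dual sol stable in auto)
  obtain \<theta> \<theta>' :: "real \<Rightarrow> real" where \<theta>:
    "smooth \<theta>" "smooth \<theta>'" "\<And>t. (\<theta> has_real_derivative \<theta>' t) (at t)" "\<And>t. \<theta>' t \<ge> 0"
    "\<And>t. t \<le> 1 \<Longrightarrow> \<theta> t = 0" "\<And>t. t \<ge> 2 \<Longrightarrow> \<theta> t = 1"
    "\<And>t. t \<le> 1 \<Longrightarrow> \<theta>' t = 0" "\<And>t. t \<ge> 2 \<Longrightarrow> \<theta>' t = 0"
    using smooth_step_exists by blast
  have cont: "continuous_on UNIV (\<lambda>t. t * \<theta>' t)"
    by (intro continuous_intros smooth_continuous_on \<theta>)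
  have supp: "t * \<theta>' t = 0" if "t \<notin> {1..2}" for t
    using that \<theta>(7,8)[of t] by (auto simp: not_le)
  obtain K where K: "\<And>t. \<bar>t * \<theta>' t\<bar> \<le> K"
    using bounded_of_continuous_compact_support[OF cont compact_Icc supp] by blast
  obtain B where B: "\<And>x. x \<in> S \<Longrightarrow> norm x \<le> B"
    using compact_imp_bounded[OF compact_S] by (auto simp: bounded_iff)
  \<comment> \<open>\<open>q_le_norm\<close> gives \<open>q x \<le> (B / a)\<^sup>2\<close> on
    \<open>S\<close>; adding 1 makes this strict and \<open>\<tau>\<close> positive.\<close>
  define \<tau> where "\<tau> = (B / a)\<^sup>2 + 1"
  have \<tau>: "q x < \<tau>" if "x \<in> S" for x
  proof -
    have "(norm x / a)\<^sup>2 \<le> (B / a)\<^sup>2"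
      using B[OF that] ab(1) by (intro power_mono divide_right_mono) auto
    then show ?thesis using q_le_norm[of x] by (simp add: \<tau>_def)
  qed
  define \<kappa> where "\<kappa> = real DIM('a) * measure lborel {x. \<rho> x \<le> 1} / 2"
  have radial: "has_bochner_integral lborel
      (\<lambda>x. q x powr (- (real DIM('a) - 2) / 2) * (f' (q x) * indicator {c..d} (q x))) (\<kappa> * (f d - f c))"
    if "0 < c" "c \<le> d" "\<And>t. c \<le> t \<Longrightarrow> t \<le> d \<Longrightarrow> (f has_real_derivative f' t) (at t)"
      "\<And>t. c \<le> t \<Longrightarrow> t \<le> d \<Longrightarrow> isCont f' t" for c d f f'
  proof -
    have exponent: "- (real DIM('a) - 2) / 2 = 1 - real DIM('a) / 2" by simp
    show ?thesis
      unfolding exponent q_def \<kappa>_def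
      by (rule radial_integral[OF rho_hom rho_pos rho_zero rho_measurable sublevel_measure(1) that])
  qed
  interpret stable_cutoff F a b \<alpha> u G S \<theta> \<theta>' K \<tau> "real DIM('a) - 2" \<kappa>
  proof unfold_locales
    show "\<tau> > 0" by (simp add: \<tau>_def add_nonneg_pos)
    show "\<kappa> > 0" using sublevel_measure(2) by (simp add: \<kappa>_def)
  qed (use \<theta> K \<tau> dim radial in \<open>simp_all\<close>)
  \<comment> \<open>With \<open>k = DIM('a) - 2\<close> the dimension bound reads
    \<open>k < 8 + 4 * min \<alpha> 0\<close>, and the right-hand side is at most
    \<open>4 * (\<alpha> + 2)\<close>.\<close>
  show False
    by (rule contradiction) (use dim in \<open>auto simp: min_def split: if_splits\<close>)
qed

end
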